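(* Let $0\le\alpha<\frac{\pi}{2}$, let $A\in\mathcal{S}_\alpha$ be an accretive $n\times n$ complex matrix, and let $t\in(0,1)$. Then $$\cos(t\alpha)\,\cos^{t}\alpha\;w(A)^t\le w(A^t)\le\sec(t\alpha)\,\sec^{2t}\alpha\;w(A)^t.$$
   Context: $\mathcal{M}_n$ is the algebra of complex $n\times n$ matrices. For $A\in\mathcal{M}_n$: $w(A)=\max\{|\langle Ax,x\rangle|:x\in\mathbb{C}^n,\|x\|=1\}$ is the numerical radius and $W(A)=\{\langle Ax,x\rangle:x\in\mathbb{C}^n,\|x\|=1\}$ is the numerical range. $A$ is accretive if $\Re A=\frac{A+A^*}{2}$ is positive definite. For $0\le\alpha<\pi/2$ let $S_\alpha=\{z\in\mathbb{C}:|\Im z|\le\tan\alpha\,\Re z\}$; we write $A\in\mathcal{S}_\alpha$ if $W(A)\subset S_\alpha$. $A^t$ denotes the principal power of the accretive matrix $A$ (whose spectrum lies in the open right half plane), defined by the holomorphic functional calculus; equivalently $A^t=\int_0^1((1-s)I+sA^{-1})^{-1}d\nu_t(s)$, where $\nu_t$ is the probability measure on $[0,1]$ with $x^t=\int_0^1((1-s)+sx^{-1})^{-1}d\nu_t(s)$ for $x>0$. *)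

theory Defs
  imports "HOL-Complex_Analysis.Residue_Theorem"
begin

text \<open>
  Vectors have type \<open>complex^'n\<close> and matrices type \<open>complex^'n^'n\<close>. The library's inner product on
  \<open>complex^'n\<close> is only the real part of the Hermitian one, so the latter is defined here. It induces
  the library's Euclidean \<open>norm\<close>.
\<close>

definition cinner :: "complex^'n \<Rightarrow> complex^'n \<Rightarrow> complex" where
  "cinner x y = (\<Sum>i\<in>UNIV. x $ i * cnj (y $ i))"

definition adj :: "complex^'n^'n \<Rightarrow> complex^'n^'n" where
  "adj A = transpose (map_matrix cnj A)"

definition numerical_range :: "complex^'n^'n \<Rightarrow> complex set" where
  "numerical_range A = {cinner (A *v x) x | x. norm x = 1}"

text \<open>The supremum below is attained, see \<open>numerical_radius_attained\<close>.\<close>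

definition numerical_radius :: "complex^'n^'n \<Rightarrow> real" where
  "numerical_radius A = Sup {cmod (cinner (A *v x) x) | x. norm x = 1}"

definition positive_definite :: "complex^'n^'n \<Rightarrow> bool" where
  "positive_definite H \<longleftrightarrow> adj H = H \<and> (\<forall>x. x \<noteq> 0 \<longrightarrow> 0 < Re (cinner (H *v x) x))"

definition real_part :: "complex^'n^'n \<Rightarrow> complex^'n^'n" where
  "real_part A = (1 / 2) *\<^sub>R (A + adj A)"

definition accretive :: "complex^'n^'n \<Rightarrow> bool" where
  "accretive A \<longleftrightarrow> positive_definite (real_part A)"

definition sector :: "real \<Rightarrow> complex set" where
  "sector \<alpha> = {z. \<bar>Im z\<bar> \<le> tan \<alpha> * Re z}"

definition sectorial :: "real \<Rightarrow> (complex^'n^'n) set" where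
  "sectorial \<alpha> = {A. numerical_range A \<subseteq> sector \<alpha>}"

definition matrix_spectrum :: "complex^'n^'n \<Rightarrow> complex set" where
  "matrix_spectrum A = {z. \<not> invertible (mat z - A)}"

text \<open>
  \<open>surrounds S K \<gamma>\<close>: the closed path \<open>\<gamma>\<close> runs in \<open>S - K\<close>, winds once around every point of \<open>K\<close>
  and not at all around points outside \<open>S\<close>.
\<close>

definition surrounds :: "complex set \<Rightarrow> complex set \<Rightarrow> (real \<Rightarrow> complex) \<Rightarrow> bool" where
  "surrounds S K \<gamma> \<longleftrightarrow> valid_path \<gamma> \<and> pathfinish \<gamma> = pathstart \<gamma> \<and> path_image \<gamma> \<subseteq> S - K \<and>
     (\<forall>z\<in>K. winding_number \<gamma> z = 1) \<and> (\<forall>z. z \<notin> S \<longrightarrow> winding_number \<gamma> z = 0)"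

text \<open>The Dunford integral of \<open>f z (zI - A)\<^sup>-\<^sup>1 / (2\<pi>i)\<close> along \<open>\<gamma>\<close>, taken entrywise.\<close>

definition dunford_integral ::
  "(real \<Rightarrow> complex) \<Rightarrow> (complex \<Rightarrow> complex) \<Rightarrow> complex^'n^'n \<Rightarrow> complex^'n^'n" where
  "dunford_integral \<gamma> f A =
     (\<chi> i j. contour_integral \<gamma> (\<lambda>z. f z * matrix_inv (mat z - A) $ i $ j) / (2 * of_real pi * \<i>))"

text \<open>
  Holomorphic functional calculus for \<open>f\<close> holomorphic on a connected open \<open>S\<close> containing the
  spectrum of \<open>A\<close>. The choice of the contour is immaterial, see \<open>dunford_integral_unique\<close>.
\<close>

definition holomorphic_calculus ::
  "complex set \<Rightarrow> (complex \<Rightarrow> complex) \<Rightarrow> complex^'n^'n \<Rightarrow> complex^'n^'n" where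
  "holomorphic_calculus S f A = dunford_integral (SOME \<gamma>. surrounds S (matrix_spectrum A) \<gamma>) f A"

definition principal_power :: "complex^'n^'n \<Rightarrow> real \<Rightarrow> complex^'n^'n" where
  "principal_power A t = holomorphic_calculus (- \<real>\<^sub>\<le>\<^sub>0) (\<lambda>z. z powr of_real t) A"

lemma cinner_self: "cinner x x = of_real ((norm x)\<^sup>2)"
proof -
  have "(norm x)\<^sup>2 = (\<Sum>i\<in>UNIV. (cmod (x $ i))\<^sup>2)"
    by (simp add: norm_vec_def L2_set_def sum_nonneg)
  then have "of_real ((norm x)\<^sup>2) = (\<Sum>i\<in>UNIV. complex_of_real ((cmod (x $ i))\<^sup>2))"
    by (simp only: of_real_sum)
  then show ?thesis
    by (simp only: cinner_def complex_norm_square)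
qed

lemma numerical_radius_attained:
  fixes A :: "complex^'n^'n"
  shows "\<exists>x. norm x = 1 \<and> cmod (cinner (A *v x) x) = numerical_radius A \<and>
           (\<forall>y. norm y = 1 \<longrightarrow> cmod (cinner (A *v y) y) \<le> cmod (cinner (A *v x) x))"
proof -
  let ?S = "sphere (0 :: complex^'n) 1" and ?g = "\<lambda>x. cmod (cinner (A *v x) x)"
  have cont: "continuous_on ?S ?g"
    unfolding cinner_def matrix_vector_mult_def vec_lambda_beta by (intro continuous_intros)
  have "(axis undefined 1 :: complex^'n) \<in> ?S"
    by (simp add: norm_axis_1)
  then have "?S \<noteq> {}"
    by blast
  from continuous_attains_sup[OF compact_sphere this cont]
  obtain x where x: "x \<in> ?S" "\<forall>y\<in>?S. ?g y \<le> ?g x"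
    by blast
  have "numerical_radius A = ?g x"
    unfolding numerical_radius_def using x by (intro cSup_eq_maximum) auto
  with x show ?thesis
    by (intro exI[of _ x]) simp
qed

lemma cinner_adj: "cinner (adj A *v x) x = cnj (cinner (A *v x) x)"
proof -
  have "cinner (adj A *v x) x = (\<Sum>i\<in>UNIV. \<Sum>j\<in>UNIV. cnj (A $ j $ i) * x $ j * cnj (x $ i))"
    by (simp add: cinner_def adj_def matrix_vector_mult_def transpose_def sum_distrib_right)
  also have "\<dots> = (\<Sum>j\<in>UNIV. \<Sum>i\<in>UNIV. cnj (A $ j $ i) * x $ j * cnj (x $ i))"
    by (rule sum.swap)
  also have "\<dots> = cnj (cinner (A *v x) x)"
    by (simp add: cinner_def matrix_vector_mult_def sum_distrib_left sum_distrib_right mult_ac)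
  finally show ?thesis .
qed

lemma Re_cinner_real_part: "Re (cinner (real_part A *v x) x) = Re (cinner (A *v x) x)"
proof -
  have "real_part A $ i $ j = (A $ i $ j + adj A $ i $ j) / 2" for i j
    by (simp only: real_part_def vector_scaleR_component) (simp add: scaleR_conv_of_real)
  then have "cinner (real_part A *v x) x = (cinner (A *v x) x + cinner (adj A *v x) x) / 2"
    by (simp add: cinner_def matrix_vector_mult_def sum_distrib_right sum_divide_distrib
        sum.distrib[symmetric] add_divide_distrib distrib_right)
  also have "\<dots> = of_real (Re (cinner (A *v x) x))"
    by (simp add: cinner_adj complex_add_cnj)
  finally show ?thesis
    by simp
qed

lemma spectrum_subset_numerical_range: "matrix_spectrum A \<subseteq> numerical_range A"
proof
  fix z assume "z \<in> matrix_spectrum A"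
  then have "\<not> (\<exists>B. B ** (mat z - A) = mat 1)"
    by (simp add: matrix_spectrum_def invertible_left_inverse)
  then obtain x where x: "x \<noteq> 0" "(mat z - A) *v x = 0"
    by (auto simp: matrix_left_invertible_ker)
  define y where "y = of_real (1 / norm x) *s x"
  have y_eq: "y = (1 / norm x) *\<^sub>R x"
    by (simp only: vec_eq_iff y_def vector_smult_component vector_scaleR_component)
      (simp add: scaleR_conv_of_real)
  have "norm y = 1"
    using x(1) by (simp add: y_eq)
  have "(mat z - A) *v y = 0"
    by (simp only: y_def vector_scalar_commute x(2)) simp
  moreover have "mat z *v y = z *s y"
    by (simp add: vec_eq_iff matrix_vector_mult_def mat_def if_distrib[of "\<lambda>u. u * _"] cong: if_cong)
  ultimately have "A *v y = z *s y"
    by (simp add: matrix_vector_mult_diff_rdistrib)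
  then have "cinner (A *v y) y = z * cinner y y"
    by (simp add: cinner_def sum_distrib_left mult_ac)
  with \<open>norm y = 1\<close> have "z = cinner (A *v y) y"
    by (simp add: cinner_self)
  with \<open>norm y = 1\<close> show "z \<in> numerical_range A"
    by (auto simp: numerical_range_def)
qed

lemma accretive_spectrum:
  assumes "accretive A" "z \<in> matrix_spectrum A"
  shows "0 < Re z"
proof -
  obtain x where x: "norm x = 1" "z = cinner (A *v x) x"
    using assms(2) spectrum_subset_numerical_range by (force simp: numerical_range_def)
  then have "x \<noteq> 0"
    by auto
  then have "0 < Re (cinner (real_part A *v x) x)"
    using assms(1) by (simp add: accretive_def positive_definite_def)
  then show ?thesis
    by (simp add: x(2) Re_cinner_real_part)
qed

lemma det_holomorphic:
  fixes M :: "complex \<Rightarrow> complex^'n^'n"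
  assumes "\<And>i j. (\<lambda>z. M z $ i $ j) holomorphic_on S"
  shows "(\<lambda>z. det (M z)) holomorphic_on S"
  unfolding det_def by (intro holomorphic_intros assms)

lemma char_matrix_holomorphic: "(\<lambda>z. (mat z - A) $ i $ j) holomorphic_on S"
  by (cases "i = j") (auto simp: mat_def intro!: holomorphic_intros)

lemma resolvent_holomorphic:
  fixes A :: "complex^'n^'n"
  shows "(\<lambda>z. matrix_inv (mat z - A) $ i $ j) holomorphic_on (S - matrix_spectrum A)"
proof -
  let ?C = "\<lambda>z. (\<chi> r c. if c = i then axis j 1 $ r else (mat z - A) $ r $ c) :: complex^'n^'n"
  have "(\<lambda>z. det (?C z) / det (mat z - A)) holomorphic_on (S - matrix_spectrum A)"
  proof (intro holomorphic_on_divide det_holomorphic)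
    show "(\<lambda>z. ?C z $ r $ c) holomorphic_on (S - matrix_spectrum A)" for r c
      using char_matrix_holomorphic[of A r c] by (cases "c = i") auto
    show "(\<lambda>z. (mat z - A) $ r $ c) holomorphic_on (S - matrix_spectrum A)" for r c
      by (rule char_matrix_holomorphic)
    show "det (mat z - A) \<noteq> 0" if "z \<in> S - matrix_spectrum A" for z
      using that by (simp add: matrix_spectrum_def invertible_det_nz)
  qed
  moreover have "det (?C z) / det (mat z - A) = matrix_inv (mat z - A) $ i $ j"
    if "z \<in> S - matrix_spectrum A" for z
  proof -
    have inv: "invertible (mat z - A)"
      using that by (simp add: matrix_spectrum_def)
    then have inv_right: "(mat z - A) ** matrix_inv (mat z - A) = mat 1"
      unfolding invertible_def matrix_inv_def by (rule someI2_ex) simp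
    let ?x = "matrix_inv (mat z - A) *v axis j 1"
    have "(mat z - A) *v ?x = axis j 1"
      using inv_right by (simp add: matrix_vector_mul_assoc)
    then have "?x $ i = det (?C z) / det (mat z - A)"
      using cramer[of "mat z - A" ?x "axis j 1"] inv by (simp add: invertible_det_nz)
    moreover have "?x $ i = matrix_inv (mat z - A) $ i $ j"
      by (simp add: matrix_vector_mult_def axis_def if_distrib[of "\<lambda>u. _ * u"] cong: if_cong)
    ultimately show ?thesis
      by simp
  qed
  ultimately show ?thesis
    by (rule holomorphic_transform)
qed

lemma finite_matrix_spectrum:
  fixes A :: "complex^'n^'n"
  shows "finite (matrix_spectrum A)"
proof -
  let ?entry = "\<lambda>i j. (if i = j then [:0, 1:] else 0) - [:A $ i $ j:]"
  define p :: "complex poly" where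
    "p = (\<Sum>\<pi> | \<pi> permutes (UNIV :: 'n set). of_int (sign \<pi>) * (\<Prod>i\<in>UNIV. ?entry i (\<pi> i)))"
  have "poly p z = det (mat z - A)" for z
    unfolding p_def det_def poly_sum poly_mult poly_prod
    by (intro sum.cong arg_cong2[where f = "(*)"] prod.cong) (auto simp: mat_def)
  then have "matrix_spectrum A = {z. poly p z = 0}"
    by (simp add: matrix_spectrum_def invertible_det_nz)
  moreover have "p \<noteq> 0"
  proof
    assume "p = 0"
    with \<open>matrix_spectrum A = _\<close> have "of_real (numerical_radius A + 1) \<in> matrix_spectrum A"
      by simp
    then obtain x where x: "norm x = 1" "of_real (numerical_radius A + 1) = cinner (A *v x) x"
      using spectrum_subset_numerical_range[of A] unfolding numerical_range_def by blast
    obtain r where r: "cmod (cinner (A *v x) x) \<le> r" "r = numerical_radius A"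
      using numerical_radius_attained[of A] x(1) by auto
    then show False
      unfolding x(2)[symmetric] norm_of_real by simp
  qed
  ultimately show ?thesis
    by (simp add: poly_roots_finite)
qed

lemma dunford_integral_unique:
  fixes A :: "complex^'n^'n"
  assumes "open S" "connected S" "f holomorphic_on S" "matrix_spectrum A \<subseteq> S"
    and "surrounds S (matrix_spectrum A) \<gamma>"
  shows "holomorphic_calculus S f A = dunford_integral \<gamma> f A"
proof -
  let ?r = "\<lambda>i j z. f z * matrix_inv (mat z - A) $ i $ j"
  have "(\<lambda>z. ?r i j z) holomorphic_on S - matrix_spectrum A" for i j
    by (intro holomorphic_intros resolvent_holomorphic holomorphic_on_subset[OF assms(3)]) auto
  then have *: "contour_integral g (?r i j) =
      2 * pi * \<i> * (\<Sum>p\<in>matrix_spectrum A. residue (?r i j) p)"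
    if "surrounds S (matrix_spectrum A) g" for g i j
    using Residue_theorem[OF assms(1,2) finite_matrix_spectrum[of A], of "?r i j" g] that
    by (simp add: surrounds_def)
  have "surrounds S (matrix_spectrum A) (SOME g. surrounds S (matrix_spectrum A) g)"
    using assms(5) by (rule someI[of "surrounds S (matrix_spectrum A)"])
  then show ?thesis
    using *[OF assms(5)] * by (simp add: holomorphic_calculus_def dunford_integral_def)
qed

lemma accretive_contour_exists:
  assumes "accretive A"
  shows "\<exists>\<gamma>. surrounds (- \<real>\<^sub>\<le>\<^sub>0) (matrix_spectrum A) \<gamma>"
proof -
  let ?K = "matrix_spectrum A"
  define c where "c = 1 + (\<Sum>z\<in>?K. (cmod z)\<^sup>2 / Re z)"
  have pos: "0 < Re z" if "z \<in> ?K" for z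
    using accretive_spectrum[OF assms that] .
  have "0 < c"
    unfolding c_def by (intro add_pos_nonneg sum_nonneg divide_nonneg_pos pos) auto
  have near: "dist (of_real c) z < c" if "z \<in> ?K" for z
  proof -
    have "(cmod z)\<^sup>2 / Re z \<le> (\<Sum>z\<in>?K. (cmod z)\<^sup>2 / Re z)"
      using that finite_matrix_spectrum by (intro member_le_sum) (auto intro!: divide_nonneg_pos pos)
    then have "(cmod z)\<^sup>2 / Re z < c"
      by (simp add: c_def)
    then have "(cmod z)\<^sup>2 < c * Re z"
      using pos[OF that] by (simp add: field_simps)
    also have "\<dots> \<le> 2 * c * Re z"
      using pos[OF that] \<open>0 < c\<close> by simp
    finally have "(cmod (of_real c - z))\<^sup>2 < c\<^sup>2"
      unfolding cmod_power2 by (simp add: power2_eq_square algebra_simps)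
    then show ?thesis
      using \<open>0 < c\<close> by (simp add: dist_norm power2_less_imp_less)
  qed
  define m where "m = Max (insert 0 (dist (of_real c) ` ?K))"
  define r where "r = (m + c) / 2"
  have "m < c"
    unfolding m_def using finite_matrix_spectrum near \<open>0 < c\<close> by (subst Max_less_iff) auto
  have m: "dist (of_real c) z \<le> m" if "z \<in> ?K" for z
    unfolding m_def using finite_matrix_spectrum that by (auto intro!: Max_ge)
  have "0 \<le> m"
    unfolding m_def using finite_matrix_spectrum by (auto intro!: Max_ge)
  have "0 < r" "r < c" "m < r"
    using \<open>0 \<le> m\<close> \<open>m < c\<close> \<open>0 < c\<close> by (auto simp: r_def)
  have far: "z \<notin> cball (of_real c) r" if "(z :: complex) \<in> \<real>\<^sub>\<le>\<^sub>0" for z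
  proof
    assume "z \<in> cball (of_real c) r"
    then have "\<bar>Re (of_real c - z)\<bar> \<le> r"
      using abs_Re_le_cmod[of "of_real c - z"] by (simp add: dist_norm)
    with that \<open>r < c\<close> show False
      by (auto simp: complex_nonpos_Reals_iff)
  qed
  have "surrounds (- \<real>\<^sub>\<le>\<^sub>0) ?K (circlepath (of_real c) r)"
    unfolding surrounds_def
  proof (intro conjI ballI allI impI)
    have "z \<in> - \<real>\<^sub>\<le>\<^sub>0 - ?K" if "dist (of_real c) z = r" for z
      using far[of z] m[of z] that \<open>m < r\<close> by auto
    then show "path_image (circlepath (of_real c) r) \<subseteq> - \<real>\<^sub>\<le>\<^sub>0 - ?K"
      using \<open>0 < r\<close> by (auto simp: dist_norm)
    show "winding_number (circlepath (of_real c) r) z = 1" if "z \<in> ?K" for z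
      using m[OF that] \<open>m < r\<close>
      by (intro winding_number_circlepath) (simp add: dist_norm norm_minus_commute)
    show "winding_number (circlepath (of_real c) r) z = 0" if "z \<notin> - \<real>\<^sub>\<le>\<^sub>0" for z
      using far[of z] that \<open>0 < r\<close>
      by (intro winding_number_zero_outside[of _ "cball (of_real c) r"]) auto
  qed auto
  then show ?thesis
    by blast
qed

end

theory Submission
  imports Defs "HOL-Analysis.Analysis"
begin

text \<open>
  On the right half plane \<open>z powr t\<close> is a multiple of the integral over \<open>u\<close> of
  \<open>exp (t * u) * z / (l + z)\<close>, where \<open>l\<close> runs along a ray \<open>exp (u + \<i> * \<theta>)\<close> and the factor
  depends on the ray merely through \<open>exp (\<i> * t * \<theta>)\<close>; the constant at \<open>\<theta> = 0\<close> is never evaluated.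
  Inserting this in the Dunford integral turns the form \<open>\<langle>A\<^sup>t x, x\<rangle>\<close> into an average of
  \<open>\<langle>A (l + A)\<^sup>-\<^sup>1 x, x\<rangle> = cnj l * \<langle>A y, y\<rangle> + (norm (A y))\<^sup>2\<close> with \<open>x = l y + A y\<close>.

  The rays \<open>\<theta> = \<plusminus>\<alpha>\<close> show that the numerical range of \<open>A\<^sup>t\<close> lies in the sector of half angle \<open>t \<alpha>\<close>,
  so that its modulus is controlled by its real part. On the positive ray that real part is compared
  with the scalar kernel \<open>H / (l + H)\<close>, which integrates to \<open>H powr t\<close>: from above with
  \<open>H = sec\<^sup>2 \<alpha> w(A)\<close> for every unit vector, from below with \<open>H\<close> the largest eigenvalue of the
  real part of \<open>A\<close> at a corresponding eigenvector, and this eigenvalue is at least \<open>cos \<alpha> w(A)\<close>.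
\<close>

subsection \<open>Powers as integrals over rays\<close>

lemma integrable_exp_abs:
  fixes a :: real
  assumes "0 < a"
  shows "integrable lborel (\<lambda>u. exp (- a * \<bar>u\<bar>))"
proof -
  have "(\<lambda>u. exp (- a * u)) integrable_on {0..}"
    using has_integral_exp_minus_to_infinity[OF assms, of 0] by blast
  then have "(\<lambda>u. exp (- a * u)) absolutely_integrable_on {0..}"
    by (intro nonnegative_absolutely_integrable_1) auto
  then have pos: "integrable lborel (\<lambda>u. indicator {0..} u *\<^sub>R exp (- a * u))"
    unfolding set_integrable_def by (subst (asm) integrable_completion) measurable
  \<comment> \<open>The reflected copy covers the negative half line; both summands are nonnegative,
    so the overlap at 0 is harmless for domination.\<close>
  have "integrable lborel (\<lambda>u. indicator {0..} u *\<^sub>R exp (- a * u)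
      + indicator {0..} (- u) *\<^sub>R exp (- a * (- u)))"
    using pos lborel_integrable_real_affine[OF pos, of "-1" 0]
      by (intro Bochner_Integration.integrable_add) auto
  then show ?thesis
    by (rule Bochner_Integration.integrable_bound) (auto simp: indicator_def)
qed

text \<open>The integrand of the Beta integral of \<open>l powr (t - 1) / (1 + l)\<close> over
  \<open>l > 0\<close>, after the substitution \<open>l = exp u\<close>.\<close>

definition power_kernel :: "real \<Rightarrow> real \<Rightarrow> real" where
  "power_kernel t u = exp (t * u) / (1 + exp u)"

text \<open>For \<open>0 < t < 1\<close> the value is \<open>pi / sin (pi * t)\<close>; its
  positivity is what allows it to be cancelled.\<close>

definition power_const :: "real \<Rightarrow> real" where
  "power_const t = (LBINT u. power_kernel t u)"

lemma power_kernel_pos: "0 < power_kernel t u"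
  by (simp add: power_kernel_def add_pos_pos)

lemma continuous_power_kernel: "continuous_on S (power_kernel t)"
proof -
  have "1 + exp u \<noteq> (0::real)" for u
    using exp_gt_zero[of u] by linarith
  then show ?thesis
    unfolding power_kernel_def by (intro continuous_intros) auto
qed

lemma integrable_power_kernel:
  assumes "0 < t" "t < 1"
  shows "integrable lborel (power_kernel t)"
proof -
  \<comment> \<open>The kernel decays like \<open>exp (t * u)\<close> on the left and like
    \<open>exp (- (1 - t) * u)\<close> on the right; \<open>a\<close> is the slower rate.\<close>
  define a where "a = min t (1 - t)"
  have "0 < a" using assms by (simp add: a_def)
  have bound: "power_kernel t u \<le> exp (- a * \<bar>u\<bar>)" for u
  proof (cases "0 \<le> u")
    case True
    have "power_kernel t u \<le> exp (t * u) / exp u"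
      unfolding power_kernel_def by (intro divide_left_mono) (auto intro!: mult_pos_pos add_pos_pos)
    also have "\<dots> = exp (- ((1 - t) * u))"
      by (simp add: exp_diff[symmetric] algebra_simps)
    also have "\<dots> \<le> exp (- a * \<bar>u\<bar>)"
      using True by (auto simp: a_def intro!: mult_right_mono)
    finally show ?thesis .
  next
    case False
    have "power_kernel t u \<le> exp (t * u) / 1"
      unfolding power_kernel_def by (intro divide_left_mono) (auto intro!: mult_pos_pos add_pos_pos)
    also have "\<dots> \<le> exp (- a * \<bar>u\<bar>)"
      using False by (auto simp: a_def intro!: mult_right_mono_neg)
    finally show ?thesis .
  qed
  show ?thesis
    by (rule Bochner_Integration.integrable_bound[OF integrable_exp_abs[OF \<open>0 < a\<close>]])
      (use bound power_kernel_pos[of t] in \<open>auto intro!: borel_measurable_continuous_onI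
          continuous_power_kernel simp: less_imp_le\<close>)
qed

lemma power_const_pos:
  assumes "0 < t" "t < 1"
  shows "0 < power_const t"
proof -
  have "0 \<le> power_const t"
    unfolding power_const_def
      by (intro Bochner_Integration.integral_nonneg) (simp add: less_imp_le power_kernel_pos)
  moreover have "power_const t \<noteq> 0"
  proof
    assume "power_const t = 0"
    then have "AE u in lborel. power_kernel t u = 0"
      unfolding power_const_def using integrable_power_kernel[OF assms]
      by (subst (asm) integral_nonneg_eq_0_iff_AE) (auto simp: less_imp_le power_kernel_pos)
    then have "AE u :: real in lborel. False"
      by eventually_elim (use power_kernel_pos in \<open>auto simp: less_le\<close>)
    then show False
      by (simp add: AE_iff_measurable[OF _ refl])
  qed
  ultimately show ?thesis by simp
qed

text \<open>Passing to real parts excludes cancellation between the ray and \<open>z\<close>. A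
  common lower bound \<open>\<delta>\<close> of \<open>Re z\<close> and \<open>cos \<theta>\<close>
  factors out and leaves the denominator of \<open>power_kernel\<close>.\<close>

lemma cmod_ray_plus_ge:
  assumes "\<delta> \<le> Re z" "\<delta> \<le> cos \<theta>"
  shows "\<delta> * (1 + exp u) \<le> cmod (exp (of_real u + \<i> * of_real \<theta>) + z)"
proof -
  have "Re (exp (of_real u + \<i> * of_real \<theta>) + z) = exp u * cos \<theta> + Re z"
    by (simp add: Re_exp)
  moreover have "\<delta> * (1 + exp u) \<le> exp u * cos \<theta> + Re z"
    using add_mono[OF mult_left_mono[OF assms(2) exp_ge_zero[of u]] assms(1)]
      by (simp only: algebra_simps)
  ultimately show ?thesis
    using complex_Re_le_cmod[of "exp (of_real u + \<i> * of_real \<theta>) + z"] by simp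
qed

lemma norm_exp_ray_quotient_le:
  assumes "0 < \<delta>" "\<delta> \<le> Re z" "\<delta> \<le> cos \<theta>"
  shows "cmod (exp (of_real (t * u)) / (exp (of_real u + \<i> * of_real \<theta>) + z))
      \<le> power_kernel t u / \<delta>"
proof -
  have "0 < \<delta> * (1 + exp u)"
    using assms(1) by (simp add: add_pos_pos)
  moreover have "cmod (exp (of_real (t * u)) / (exp (of_real u + \<i> * of_real \<theta>) + z))
      = exp (t * u) / cmod (exp (of_real u + \<i> * of_real \<theta>) + z)"
    by (simp add: norm_divide)
  ultimately show ?thesis
    unfolding power_kernel_def
    using frac_le[OF exp_ge_zero order_refl _ cmod_ray_plus_ge[OF assms(2,3), of u], of "t * u"]
    by (simp add: mult.commute)
qed

text \<open>Exchanges the ray integral with a parametrized contour integral. Continuity gives joint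
  measurability, and \<open>G u\<close> times the indicator of \<open>{0..1}\<close> is an
  integrable majorant on the product.\<close>

lemma fubini_Icc:
  fixes F :: "real \<Rightarrow> real \<Rightarrow> complex"
  assumes cont: "continuous_on UNIV (\<lambda>(u, s). F u s)"
    and bound: "\<And>u s. s \<in> {0..1} \<Longrightarrow> cmod (F u s) \<le> G u"
    and G: "integrable lborel G"
  shows "integrable lborel (\<lambda>u. integral {0..1} (F u))" (is ?int)
    and "(LBINT u. integral {0..1} (F u)) = integral {0..1} (\<lambda>s. LBINT u. F u s)" (is ?eq)
proof -
  \<comment> \<open>Extension by zero puts both variables under \<open>lborel\<close>; the integral
    over \<open>{0..1}\<close> is recovered slice by slice.\<close>
  define H where "H = (\<lambda>u s. indicator {0..1::real} s *\<^sub>R F u s)"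
  have meas: "(\<lambda>(u, s). H u s) \<in> borel_measurable (lborel \<Otimes>\<^sub>M lborel)"
  proof -
    have "(\<lambda>p. case p of (u, s) \<Rightarrow> F u s) \<in> borel_measurable borel"
      by (rule borel_measurable_continuous_onI[OF cont])
    then have [measurable]: "(\<lambda>p. F (fst p) (snd p)) \<in> borel_measurable (borel \<Otimes>\<^sub>M borel)"
      by (simp add: borel_prod case_prod_unfold)
    show ?thesis
      unfolding H_def case_prod_unfold by measurable
  qed
  have prod: "integrable (lborel \<Otimes>\<^sub>M lborel) (\<lambda>(u, s). H u s)"
  proof (rule Bochner_Integration.integrable_bound)
    show "integrable (lborel \<Otimes>\<^sub>M lborel) (\<lambda>(u :: real, s :: real). G u * indicator {0..1} s)"
    proof (rule lborel_pair.Fubini_integrable)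
      show "(\<lambda>(u, s). G u * indicator {0..1::real} s) \<in> borel_measurable (lborel \<Otimes>\<^sub>M lborel)"
        using borel_measurable_integrable[OF G] by measurable
    qed (use G in \<open>auto simp: abs_mult\<close>)
    show "AE p in lborel \<Otimes>\<^sub>M lborel. cmod (case p of (u, s) \<Rightarrow> H u s)
        \<le> norm (case p of (u, s) \<Rightarrow> G u * indicator {0..1} s)"
      using order_trans[OF bound abs_ge_self] by (intro AE_I2) (auto simp: H_def indicator_def)
  qed (rule meas)
  have slice: "continuous_on S (F u)" for u S
  proof -
    have "continuous_on S (\<lambda>s. (\<lambda>(u, s). F u s) (u, s))"
      by (intro continuous_on_compose2[OF cont] continuous_intros) auto
    then show ?thesis by simp
  qed
  have inner: "(LBINT s. H u s) = integral {0..1} (F u)" for u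
    using set_borel_integral_eq_integral(2)[OF borel_integrable_atLeastAtMost'[OF slice]]
    by (simp add: H_def set_lebesgue_integral_def)
  show ?int
    using lborel_pair.integrable_fst'[OF prod] by (simp add: inner)
  have int2: "integrable lborel (\<lambda>s. LBINT u. H u s)"
    using lborel_pair.integrable_snd[of H] prod by simp
  have "(LBINT u. integral {0..1} (F u)) = (LBINT s. LBINT u. H u s)"
    using lborel_pair.Fubini_integral[OF prod] by (simp add: inner)
  also have "\<dots> = (LINT s:{0..1}|lborel. LBINT u. F u s)"
    by (simp add: H_def set_lebesgue_integral_def)
  also have "\<dots> = integral {0..1} (\<lambda>s. LBINT u. F u s)"
    using int2 by (intro set_borel_integral_eq_integral(2)) (simp add: H_def set_integrable_def)
  finally show ?eq .
qed

section \<open>Shifting the line of integration in a pole-free strip\<close>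

lemma exp_plus_one_nonzero:
  assumes "\<bar>Im v\<bar> < pi"
  shows "exp v + 1 \<noteq> 0"
proof
  assume "exp v + 1 = 0"
  then have *: "exp v = - 1" by (simp add: eq_neg_iff_add_eq_0)
  have "sin (Im v) = 0"
    using arg_cong[OF *, of Im] by (simp add: Im_exp)
  then have "Im v = 0"
    using assms \<open>sin (Im v) = 0\<close> by (auto dest: sin_eq_0_pi[rotated 2])
  then show False
    using arg_cong[OF *, of Re] exp_gt_zero[of "Re v"] by (simp add: Re_exp del: exp_gt_zero)
qed

text \<open>For \<open>1 \<le> \<bar>Re v\<bar>\<close> one of the terms \<open>exp v\<close> and
  \<open>1\<close> has at least twice the modulus of the other, so the denominator keeps half of the
  larger one. For \<open>0 < t < 1\<close> this gives exponential decay at both ends.\<close>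

lemma norm_exp_quotient_le:
  fixes v :: complex
  shows "1 \<le> Re v \<Longrightarrow> cmod (exp (of_real t * v) / (exp v + 1)) \<le> 2 * exp ((t - 1) * Re v)"
    and "Re v \<le> -1 \<Longrightarrow> cmod (exp (of_real t * v) / (exp v + 1)) \<le> 2 * exp (t * Re v)"
proof -
  have e1: "2 \<le> exp (1::real)"
    using exp_ge_add_one_self[of 1] by simp
  show "cmod (exp (of_real t * v) / (exp v + 1)) \<le> 2 * exp ((t - 1) * Re v)" if "1 \<le> Re v"
  proof -
    have "exp 1 \<le> exp (Re v)" using that by simp
    then have "exp (Re v) / 2 \<le> exp (Re v) - 1" using e1 by linarith
    also have "\<dots> \<le> cmod (exp v + 1)"
      using norm_diff_ineq[of "exp v" 1] by simp
    finally have "exp (t * Re v) / cmod (exp v + 1) \<le> exp (t * Re v) / (exp (Re v) / 2)"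
      by (intro frac_le) auto
    also have "\<dots> = 2 * exp ((t - 1) * Re v)"
      by (simp add: exp_diff left_diff_distrib)
    finally show ?thesis by (simp add: norm_divide)
  qed
  show "cmod (exp (of_real t * v) / (exp v + 1)) \<le> 2 * exp (t * Re v)" if "Re v \<le> -1"
  proof -
    have "exp (Re v) \<le> exp (-1)" using that by simp
    also have "\<dots> \<le> 1 / 2" using e1 by (simp add: exp_minus field_simps)
    finally have "1 / 2 \<le> 1 - exp (Re v)" by simp
    also have "\<dots> \<le> cmod (exp v + 1)"
      using norm_diff_ineq[of 1 "exp v"] by (simp add: add.commute)
    finally have "exp (t * Re v) / cmod (exp v + 1) \<le> exp (t * Re v) / (1 / 2)"
      by (intro frac_le) auto
    then show ?thesis by (simp add: norm_divide)
  qed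
qed

text \<open>
  The shift moves the line of integration inside a strip where \<open>g\<close> has a primitive, so only the
  ends at infinity matter.
\<close>

lemma integral_eq_shifted_integral:
  fixes b :: complex and t :: real
  defines "g \<equiv> \<lambda>v. exp (of_real t * v) / (exp v + 1)"
  assumes t: "0 < t" "t < 1" and b: "\<bar>Im b\<bar> < pi"
    and int: "integrable lborel (\<lambda>u. g (of_real u))" "integrable lborel (\<lambda>u. g (of_real u + b))"
  shows "(LBINT u. g (of_real u + b)) = (LBINT u. g (of_real u))"
proof -
  define S where "S = {v. \<bar>Im v\<bar> < pi}"
  have S_eq: "S = {v. Im v < pi} \<inter> {v. - pi < Im v}"
    by (auto simp: S_def)
  have S: "convex S" "open S"
    unfolding S_eq
      by (auto intro!: convex_Int open_Int convex_halfspace_Im_lt convex_halfspace_Im_gt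
        open_halfspace_Im_lt open_halfspace_Im_gt)
  have hol: "g holomorphic_on S"
    unfolding g_def by (intro holomorphic_intros) (auto simp: S_def exp_plus_one_nonzero)
  obtain G where G: "\<And>v. v \<in> S \<Longrightarrow> (G has_field_derivative g v) (at v within S)"
    using holomorphic_convex_primitive'[OF S hol] by blast
  then have G_at: "(G has_field_derivative g v) (at v)" if "v \<in> S" for v
    using that at_within_open[OF that S(2)] by metis
  have in_S: "of_real u \<in> S" "of_real u + b \<in> S" for u :: real
    using b by (auto simp: S_def)
  \<comment> \<open>\<open>D u\<close> is the integral of \<open>g\<close> over the segment from
    \<open>u\<close> to \<open>u + b\<close>, expressed by the primitive.\<close>
  define D where "D = (\<lambda>u :: real. G (of_real u + b) - G (of_real u))"
  have D_deriv: "(D has_vector_derivative g (of_real u + b) - g (of_real u)) (at u)" for u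
  proof -
    have "((\<lambda>v. G (v + b)) has_field_derivative g (of_real u + b)) (at (of_real u))"
      using G_at[OF in_S(2)[of u]] by (simp only: DERIV_shift)
    then show ?thesis
      unfolding D_def
      by (intro has_vector_derivative_diff has_vector_derivative_real_field G_at in_S)
  qed
  \<comment> \<open>Along that segment real parts stay within \<open>cmod b\<close> of
    \<open>u\<close>, so a bound for \<open>g\<close> on this vertical strip suffices.\<close>
  have D_bound: "cmod (D u) \<le> B * cmod b"
    if "\<And>v. \<bar>Re v - u\<bar> \<le> cmod b \<Longrightarrow> cmod (g v) \<le> B" for u B
  proof -
    let ?L = "closed_segment (of_real u) (of_real u + b)"
    have L: "?L \<subseteq> S"
      using in_S S(1) by (intro closed_segment_subset) auto
    have "\<bar>Re v - u\<bar> \<le> cmod b" if "v \<in> ?L" for v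
    proof -
      have "cmod (v - of_real u) \<le> cmod b"
        using segment_bound(1)[OF that] by (simp add: norm_minus_commute)
      then show ?thesis
        using abs_Re_le_cmod[of "v - of_real u"] by simp
    qed
    then have "cmod (G (of_real u + b) - G (of_real u)) \<le> B * cmod (of_real u + b - of_real u)"
      using that L
        by (intro field_differentiable_bound[of ?L G g] has_field_derivative_subset[OF G]) auto
    then show ?thesis by (simp add: D_def)
  qed
  let ?c = "cmod b"
  have top: "(D \<longlongrightarrow> 0) at_top"
  proof (rule Lim_null_comparison)
    show "\<forall>\<^sub>F u in at_top. norm (D u) \<le> (2 * exp ((t - 1) * (- ?c + u))) * ?c"
      using eventually_ge_at_top[of "1 + ?c"]
    proof eventually_elim
      case (elim u)
      have "cmod (g v) \<le> 2 * exp ((t - 1) * (- ?c + u))" if "\<bar>Re v - u\<bar> \<le> ?c" for v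
      proof -
        have "cmod (g v) \<le> 2 * exp ((t - 1) * Re v)"
          unfolding g_def using elim that by (intro norm_exp_quotient_le) linarith
        also have "\<dots> \<le> 2 * exp ((t - 1) * (- ?c + u))"
          using t that by (auto intro!: mult_left_mono_neg)
        finally show ?thesis .
      qed
      then show ?case by (rule D_bound)
    qed
    have "filterlim (\<lambda>u. (t - 1) * (- ?c + u)) at_bot at_top"
      using t filterlim_tendsto_add_at_top[OF tendsto_const[of "- ?c"] filterlim_ident]
      by (intro filterlim_tendsto_neg_mult_at_bot[OF tendsto_const]) auto
    then have "((\<lambda>u. exp ((t - 1) * (- ?c + u))) \<longlongrightarrow> 0) at_top"
      by (rule filterlim_compose[OF exp_at_bot])
    then show "((\<lambda>u. (2 * exp ((t - 1) * (- ?c + u))) * ?c) \<longlongrightarrow> 0) at_top"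
      by (intro tendsto_mult_left_zero tendsto_mult_right_zero)
  qed
  have bot: "(D \<longlongrightarrow> 0) at_bot"
  proof (rule Lim_null_comparison)
    show "\<forall>\<^sub>F u in at_bot. norm (D u) \<le> (2 * exp (t * (?c + u))) * ?c"
      using eventually_le_at_bot[of "- 1 - ?c"]
    proof eventually_elim
      case (elim u)
      have "cmod (g v) \<le> 2 * exp (t * (?c + u))" if "\<bar>Re v - u\<bar> \<le> ?c" for v
      proof -
        have "cmod (g v) \<le> 2 * exp (t * Re v)"
          unfolding g_def using elim that by (intro norm_exp_quotient_le) linarith
        also have "\<dots> \<le> 2 * exp (t * (?c + u))"
          using t that by (auto intro!: mult_left_mono)
        finally show ?thesis .
      qed
      then show ?case by (rule D_bound)
    qed
    have "filterlim (\<lambda>u. t * (?c + u)) at_bot at_bot"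
      using t filterlim_tendsto_add_at_bot_iff[OF tendsto_const[of "?c"], THEN iffD2,
          OF filterlim_ident]
      by (intro filterlim_tendsto_pos_mult_at_bot[OF tendsto_const]) auto
    then have "((\<lambda>u. exp (t * (?c + u))) \<longlongrightarrow> 0) at_bot"
      by (rule filterlim_compose[OF exp_at_bot])
    then show "((\<lambda>u. (2 * exp (t * (?c + u))) * ?c) \<longlongrightarrow> 0) at_bot"
      by (intro tendsto_mult_left_zero tendsto_mult_right_zero)
  qed
  have "continuous_on UNIV (\<lambda>u :: real. g (of_real u + b) - g (of_real u))"
    using in_S
      by (intro continuous_intros
        continuous_on_compose2[OF holomorphic_on_imp_continuous_on[OF hol]]) auto
  then have cont: "isCont (\<lambda>u :: real. g (of_real u + b) - g (of_real u)) u" for u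
    by (simp add: continuous_on_eq_continuous_at)
  \<comment> \<open>The difference of the two integrals is the total increment of \<open>D\<close>,
    which tends to 0 at both ends.\<close>
  have "(LBINT u=-\<infinity>..\<infinity>. g (of_real u + b) - g (of_real u)) = 0 - 0"
  proof (rule interval_integral_FTC_integrable[where F = D])
    show "set_integrable lborel (einterval (- \<infinity>) \<infinity>) (\<lambda>u. g (of_real u + b) - g (of_real u))"
      using int by (simp add: set_integrable_def)
    show "((D \<circ> real_of_ereal) \<longlongrightarrow> 0) (at_left \<infinity>)" "((D \<circ> real_of_ereal) \<longlongrightarrow> 0) (at_right (- \<infinity>))"
      using top bot by (simp_all add: ereal_tendsto_simps)
  qed (rule D_deriv cont | simp)+
  then show ?thesis
    using int by (simp add: interval_lebesgue_integral_def set_lebesgue_integral_def)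
qed

lemma exp_ray_plus_nonzero:
  assumes "0 < Re z" "\<bar>\<theta>\<bar> < pi / 2"
  shows "exp (of_real u + \<i> * of_real \<theta>) + z \<noteq> 0"
proof -
  have "0 < cos \<theta>"
    using assms(2) by (intro cos_gt_zero_pi) auto
  then have "0 < Re (exp (of_real u + \<i> * of_real \<theta>) + z)"
    using assms(1) by (simp add: Re_exp add_pos_pos)
  then show ?thesis by (metis less_irrefl zero_complex.sel(1))
qed

lemma ray_integral:
  fixes z :: complex
  assumes t: "0 < t" "t < 1" and z: "0 < Re z" and \<theta>: "\<bar>\<theta>\<bar> < pi / 2"
  shows "integrable lborel (\<lambda>u. exp (of_real (t * u)) / (exp (of_real u + \<i> * of_real \<theta>) + z))"
      (is "integrable lborel ?h")
    and "exp (\<i> * of_real (t * \<theta>)) *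
        (z * (LBINT u. exp (of_real (t * u)) / (exp (of_real u + \<i> * of_real \<theta>) + z)))
      = z powr of_real t * of_real (power_const t)"
proof -
  have cos: "0 < cos \<theta>"
    using \<theta> by (intro cos_gt_zero_pi) auto
  define \<delta> where "\<delta> = min (Re z) (cos \<theta>)"
  have \<delta>: "0 < \<delta>" "\<delta> \<le> Re z" "\<delta> \<le> cos \<theta>"
    using z cos by (auto simp: \<delta>_def)
  show int: "integrable lborel ?h"
  proof (rule Bochner_Integration.integrable_bound)
    show "integrable lborel (\<lambda>u. power_kernel t u / \<delta>)"
      using integrable_power_kernel[OF t] by simp
    have "continuous_on UNIV ?h"
      by (intro continuous_intros) (auto simp: exp_ray_plus_nonzero[OF z \<theta>])
    then show "?h \<in> borel_measurable lborel"
      by (simp add: borel_measurable_continuous_onI)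
    show "AE u in lborel. cmod (?h u) \<le> norm (power_kernel t u / \<delta>)"
      unfolding real_norm_def
      by (intro AE_I2 order_trans[OF norm_exp_ray_quotient_le[OF \<delta>, of t] abs_ge_self])
  qed
  \<comment> \<open>Division by \<open>z\<close> turns the ray into \<open>exp (u + b)\<close>, and
    \<open>exp (t * b)\<close> produces the phase and the power of \<open>z\<close>. Both
    \<open>\<theta>\<close> and \<open>Im (Ln z)\<close> are below \<open>pi / 2\<close> in modulus,
    so the shift stays in the strip.\<close>
  define b where "b = \<i> * of_real \<theta> - Ln z"
  define g where "g = (\<lambda>v :: complex. exp (of_real t * v) / (exp v + 1))"
  have "z \<noteq> 0" using z by auto
  have "\<bar>Im (Ln z)\<bar> < pi / 2"
    using z by (rule Re_Ln_pos_lt_imp)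
  then have b: "\<bar>Im b\<bar> < pi"
    using \<theta> by (simp add: b_def)
  have shifted: "g (of_real u + b) * z powr of_real t
      = exp (\<i> * of_real (t * \<theta>)) * (z * ?h u)" for u
  proof -
    have "of_real u + b = (of_real u + \<i> * of_real \<theta>) - Ln z"
      by (simp add: b_def)
    then have 1: "exp (of_real u + b) = exp (of_real u + \<i> * of_real \<theta>) / z"
      using \<open>z \<noteq> 0\<close> by (simp only: exp_diff exp_Ln[OF \<open>z \<noteq> 0\<close>])
    have "of_real t * (of_real u + b) + of_real t * Ln z = of_real (t * u) + \<i> * of_real (t * \<theta>)"
      by (simp add: b_def algebra_simps)
    then have "exp (of_real t * (of_real u + b)) * exp (of_real t * Ln z)
        = exp (of_real (t * u)) * exp (\<i> * of_real (t * \<theta>))"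
      by (simp only: exp_add[symmetric])
    then have 2: "exp (of_real t * (of_real u + b)) * z powr of_real t
        = exp (of_real (t * u)) * exp (\<i> * of_real (t * \<theta>))"
      using \<open>z \<noteq> 0\<close> by (simp add: powr_def)
    have 3: "exp (of_real u + \<i> * of_real \<theta>) / z + 1 = (exp (of_real u + \<i> * of_real \<theta>) + z) / z"
      using \<open>z \<noteq> 0\<close> by (simp add: field_simps)
    have "g (of_real u + b) * z powr of_real t
        = (exp (of_real t * (of_real u + b)) * z powr of_real t) / (exp (of_real u + b) + 1)"
      by (simp add: g_def)
    also have "\<dots> = exp (\<i> * of_real (t * \<theta>)) * (z * ?h u)"
      unfolding 1 2 3 by simp
    finally show ?thesis .
  qed
  have powr_nz: "z powr of_real t \<noteq> 0" using \<open>z \<noteq> 0\<close> by simp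
  have shifted': "g (of_real u + b)
      = exp (\<i> * of_real (t * \<theta>)) * (z * ?h u) / z powr of_real t" for u
    using shifted[of u] by (rule nonzero_eq_divide_eq[OF powr_nz, THEN iffD2])
  have "integrable lborel (\<lambda>u. g (of_real u + b))"
    unfolding shifted'
      by (intro Bochner_Integration.integrable_divide Bochner_Integration.integrable_mult_right int)
  moreover have real: "g (of_real u) = of_real (power_kernel t u)" for u
    by (simp add: g_def power_kernel_def exp_of_real add.commute flip: of_real_mult)
  have "integrable lborel (\<lambda>u. g (of_real u))"
    unfolding real using integrable_power_kernel[OF t] by simp
  ultimately have "(LBINT u. g (of_real u + b)) = (LBINT u. g (of_real u))"
    unfolding g_def by (intro integral_eq_shifted_integral[OF t b])
  also have "\<dots> = of_real (power_const t)"
    by (simp add: real power_const_def)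
  finally have "exp (\<i> * of_real (t * \<theta>)) * (z * (LBINT u. ?h u)) / z powr of_real t
      = of_real (power_const t)"
    unfolding shifted' by (simp only: integral_divide_zero integral_mult_right_zero)
  then show "exp (\<i> * of_real (t * \<theta>)) * (z * (LBINT u. ?h u))
      = z powr of_real t * of_real (power_const t)"
    by (simp only: nonzero_divide_eq_eq[OF powr_nz]) (simp add: mult.commute)
qed

subsection \<open>Resolvents and the Dunford integral\<close>

lemma cinner_add_left: "cinner (x + y) z = cinner x z + cinner y z"
  and cinner_diff_left: "cinner (x - y) z = cinner x z - cinner y z"
  and cinner_scale_left: "cinner (c *s x) z = c * cinner x z"
  and cinner_add_right: "cinner z (x + y) = cinner z x + cinner z y"
  and cinner_diff_right: "cinner z (x - y) = cinner z x - cinner z y"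
  and cinner_scale_right: "cinner z (c *s x) = cnj c * cinner z x"
  by (simp_all add: cinner_def algebra_simps sum.distrib sum_subtractf sum_distrib_left)

lemmas cinner_simps = cinner_add_left cinner_diff_left cinner_scale_left
  cinner_add_right cinner_diff_right cinner_scale_right

lemma cinner_zero_left [simp]: "cinner 0 x = 0"
  by (simp add: cinner_def)

lemma cinner_minus_left: "cinner (- x) y = - cinner x y"
  by (simp add: cinner_def sum_negf)

lemma cinner_commute: "cinner y x = cnj (cinner x y)"
  by (simp add: cinner_def mult.commute)

lemma cmod_cinner_le: "cmod (cinner x y) \<le> norm x * norm y"
proof -
  have "cmod (cinner x y) \<le> (\<Sum>i\<in>UNIV. \<bar>cmod (x $ i)\<bar> * \<bar>cmod (y $ i)\<bar>)"
    unfolding cinner_def by (rule order_trans[OF norm_sum]) (simp add: norm_mult)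
  also have "\<dots> \<le> norm x * norm y"
    unfolding norm_vec_def by (rule L2_set_mult_ineq)
  finally show ?thesis .
qed

lemma norm_scale: "norm (c *s x) = cmod c * norm x" for x :: "complex^'n"
  by (simp add: norm_vec_def norm_mult L2_set_right_distrib)

lemma mat_mult_vector: "mat c *v x = c *s x"
  by (simp add: vec_eq_iff matrix_vector_mult_def mat_def if_distrib[of "\<lambda>u. u * _"] cong: if_cong)

lemma resolvent_inverse:
  assumes "z \<notin> matrix_spectrum A"
  shows "z *s (matrix_inv (mat z - A) *v x) - A *v (matrix_inv (mat z - A) *v x) = x"
    and "matrix_inv (mat z - A) *v (z *s x - A *v x) = x"
proof -
  have "\<exists>B. (mat z - A) ** B = mat 1 \<and> B ** (mat z - A) = mat 1"
    using assms by (simp add: matrix_spectrum_def invertible_def)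
  then have *: "(mat z - A) ** matrix_inv (mat z - A) = mat 1
      \<and> matrix_inv (mat z - A) ** (mat z - A) = mat 1"
    unfolding matrix_inv_def by (rule someI_ex)
  have e: "z *s y - A *v y = (mat z - A) *v y" for y
    by (simp add: matrix_vector_mult_diff_rdistrib mat_mult_vector)
  show "z *s (matrix_inv (mat z - A) *v x) - A *v (matrix_inv (mat z - A) *v x) = x"
    unfolding e using * by (simp add: matrix_vector_mul_assoc)
  show "matrix_inv (mat z - A) *v (z *s x - A *v x) = x"
    unfolding e using * by (simp add: matrix_vector_mul_assoc)
qed

lemma resolvent_identity:
  assumes "z \<notin> matrix_spectrum A" "w \<notin> matrix_spectrum A"
  shows "(w - z) *s (matrix_inv (mat z - A) *v (matrix_inv (mat w - A) *v x))
    = matrix_inv (mat z - A) *v x - matrix_inv (mat w - A) *v x"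
proof -
  define y where "y = matrix_inv (mat w - A) *v x"
  have "(w - z) *s y = x - (z *s y - A *v y)"
    using resolvent_inverse(1)[OF assms(2), of x]
    unfolding y_def[symmetric] by (simp add: vec_eq_iff algebra_simps)
  then have "matrix_inv (mat z - A) *v ((w - z) *s y) = matrix_inv (mat z - A) *v x - y"
    by (simp only:) (subst matrix_vector_mult_diff_distrib,
        simp only: resolvent_inverse(2)[OF assms(1)])
  then show ?thesis
    by (simp only: y_def vector_scalar_commute)
qed

lemma resolvent_form_holomorphic:
  "(\<lambda>z. cinner (matrix_inv (mat z - A) *v x) y) holomorphic_on (S - matrix_spectrum A)"
  unfolding cinner_def matrix_vector_mult_def vec_lambda_beta
  by (intro holomorphic_intros resolvent_holomorphic)

text \<open>The integral is entrywise, so the finite double sum of the form passes under it once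
  every entry is contour integrable.\<close>

lemma cinner_dunford_integral:
  fixes A :: "complex^'n^'n"
  assumes "open S" "f holomorphic_on S" "valid_path \<gamma>" "path_image \<gamma> \<subseteq> S - matrix_spectrum A"
  shows "cinner (dunford_integral \<gamma> f A *v x) y =
    contour_integral \<gamma> (\<lambda>z. f z * cinner (matrix_inv (mat z - A) *v x) y) / (2 * of_real pi * \<i>)"
proof -
  let ?R = "\<lambda>z i j. matrix_inv (mat z - A) $ i $ j"
  let ?c = "\<lambda>i j. contour_integral \<gamma> (\<lambda>z. f z * ?R z i j)"
  have "open (S - matrix_spectrum A)"
    using assms(1) finite_matrix_spectrum by (intro open_Diff finite_imp_closed)
  then have "((\<lambda>z. f z * ?R z i j) has_contour_integral ?c i j) \<gamma>" for i j
    using assms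
    by (intro has_contour_integral_integral
        contour_integrable_holomorphic_simple[of _ "S - matrix_spectrum A"]
        holomorphic_intros resolvent_holomorphic holomorphic_on_subset[OF assms(2)]) auto
  then have "((\<lambda>z. \<Sum>i\<in>UNIV. \<Sum>j\<in>UNIV. (f z * ?R z i j) * (x $ j * cnj (y $ i))) has_contour_integral
      (\<Sum>i\<in>UNIV. \<Sum>j\<in>UNIV. ?c i j * (x $ j * cnj (y $ i)))) \<gamma>"
    by (intro has_contour_integral_sum has_contour_integral_rmul) auto
  moreover have "(\<Sum>i\<in>UNIV. \<Sum>j\<in>UNIV. (f z * ?R z i j) * (x $ j * cnj (y $ i)))
      = f z * cinner (matrix_inv (mat z - A) *v x) y" for z
    by (simp add: cinner_def matrix_vector_mult_def sum_distrib_left sum_distrib_right mult_ac)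
  ultimately have "contour_integral \<gamma> (\<lambda>z. f z * cinner (matrix_inv (mat z - A) *v x) y)
      = (\<Sum>i\<in>UNIV. \<Sum>j\<in>UNIV. ?c i j * (x $ j * cnj (y $ i)))"
    by (simp add: contour_integral_unique)
  then show ?thesis
    by (simp add: cinner_def matrix_vector_mult_def dunford_integral_def sum_divide_distrib
        sum_distrib_left sum_distrib_right mult_ac)
qed

section \<open>Circles around the spectrum and the integral of the resolvent\<close>

lemma circlepath_surrounds:
  assumes "0 < r" "K \<subseteq> ball c r" "cball c r \<subseteq> S"
  shows "surrounds S K (circlepath c r)"
  unfolding surrounds_def
proof (intro conjI ballI allI impI)
  show "path_image (circlepath c r) \<subseteq> S - K"
    using assms by (force simp: subset_iff)
  show "winding_number (circlepath c r) z = 1" if "z \<in> K" for z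
    using that assms(2)
      by (intro winding_number_circlepath) (auto simp: dist_norm norm_minus_commute)
  show "winding_number (circlepath c r) z = 0" if "z \<notin> S" for z
    using that assms(1,3)
    by (intro winding_number_zero_outside[of _ "cball c r"]) auto
qed auto

lemma half_plane_circle_exists:
  assumes "finite K" "\<And>z. z \<in> K \<Longrightarrow> 0 < Re z"
  obtains c r :: real where "0 < r" "r < c" "K \<subseteq> ball (of_real c) r"
proof -
  define \<delta> where "\<delta> = Min (insert 1 (Re ` K))"
  have \<delta>: "0 < \<delta>" "\<And>z. z \<in> K \<Longrightarrow> \<delta> \<le> Re z"
    using assms by (auto simp: \<delta>_def)
  obtain M where M: "\<And>z. z \<in> K \<Longrightarrow> cmod z \<le> M"
    using finite_imp_bounded[OF assms(1)] by (auto simp: bounded_iff)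
  \<comment> \<open>The choice gives \<open>M\<^sup>2 < c * \<delta>\<close>, hence \<open>c\<^sup>2
    - 2 * c * \<delta> + M\<^sup>2 < (c - \<delta> / 2)\<^sup>2\<close>, where the left side bounds
    the squared distance from \<open>c\<close> to \<open>K\<close>. The radius
    \<open>c - \<delta> / 2\<close> keeps the circle off the imaginary axis.\<close>
  define c where "c = M\<^sup>2 / \<delta> + \<delta>"
  have c: "\<delta> \<le> c" "M\<^sup>2 < c * \<delta>"
    using \<delta>(1) by (auto simp: c_def field_simps)
  have "z \<in> ball (of_real c) (c - \<delta> / 2)" if "z \<in> K" for z
  proof -
    have "(cmod z)\<^sup>2 \<le> M\<^sup>2"
      using M[OF that] by (intro power_mono) auto
    moreover have "c * \<delta> \<le> c * Re z"
      using \<delta> c that by (intro mult_left_mono) auto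
    moreover have "(cmod (of_real c - z))\<^sup>2 = c\<^sup>2 - 2 * (c * Re z) + (cmod z)\<^sup>2"
      unfolding cmod_power2 by (simp add: power2_eq_square algebra_simps)
    moreover have "(c - \<delta> / 2)\<^sup>2 = c\<^sup>2 - c * \<delta> + (\<delta> / 2)\<^sup>2"
      by (simp add: power2_eq_square algebra_simps)
    ultimately have "(cmod (of_real c - z))\<^sup>2 < (c - \<delta> / 2)\<^sup>2"
      using c(2) zero_le_power2[of "\<delta> / 2"] by linarith
    then show ?thesis
      using c(1) \<delta>(1) by (simp add: dist_norm power2_less_imp_less)
  qed
  then show thesis
    using \<delta>(1) c(1) by (intro that[of "c - \<delta> / 2" c]) auto
qed

text \<open>The resolvent behaves like \<open>1 / z\<close> at infinity, so the circle is replaced by large ones.\<close>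

lemma contour_integral_resolvent_form:
  fixes A :: "complex^'n^'n"
  assumes "0 < r" "matrix_spectrum A \<subseteq> ball c r"
  shows "contour_integral (circlepath c r) (\<lambda>z. cinner (matrix_inv (mat z - A) *v v) w)
      = 2 * of_real pi * \<i> * cinner v w"
proof -
  let ?\<rho> = "\<lambda>z. cinner (matrix_inv (mat z - A) *v v) w"
  let ?I = "contour_integral (circlepath c r) ?\<rho>"
  \<comment> \<open>The integral is a form of the Dunford integral of the constant 1 over
    \<open>UNIV\<close>, which is independent of the contour.\<close>
  have indep: "contour_integral (circlepath a s) ?\<rho> = ?I"
    if s: "0 < s" "matrix_spectrum A \<subseteq> ball a s" for a s
  proof -
    have "cinner (holomorphic_calculus UNIV (\<lambda>_. 1) A *v v) w
        = contour_integral (circlepath b q) ?\<rho> / (2 * of_real pi * \<i>)"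
      if "0 < q" "matrix_spectrum A \<subseteq> ball b q" for b q
    proof -
      have sur: "surrounds UNIV (matrix_spectrum A) (circlepath b q)"
        using that by (intro circlepath_surrounds) auto
      then show ?thesis
        using dunford_integral_unique[OF open_UNIV connected_UNIV _ _ sur, of "\<lambda>_. 1"]
          cinner_dunford_integral[of UNIV "\<lambda>_. 1" "circlepath b q" A v w]
        by (simp add: surrounds_def)
    qed
    from this[OF s] this[OF assms] show ?thesis by simp
  qed
  obtain B where B: "0 < B" "\<And>y. norm (A *v y) \<le> B * norm y"
    using bounded_linear.pos_bounded[OF matrix_vector_mul_bounded_linear[of A]]
      by (metis mult.commute)
  obtain M where M: "\<And>z. z \<in> matrix_spectrum A \<Longrightarrow> cmod z \<le> M"
    using finite_imp_bounded[OF finite_matrix_spectrum[of A]] by (auto simp: bounded_iff)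
  define C where "C = 2 * pi * B * norm v * norm w"
  have bound: "cmod (?I - 2 * of_real pi * \<i> * cinner v w) \<le> C / (s - B)"
    if s: "B < s" "M < s" for s
  proof -
    have "0 < s" using B(1) s by simp
    have spec: "matrix_spectrum A \<subseteq> ball 0 s"
      using M s by fastforce
    have path: "path_image (circlepath 0 s) \<subseteq> - matrix_spectrum A"
      using spec \<open>0 < s\<close> by auto
    have "open (UNIV - matrix_spectrum A)"
      using finite_matrix_spectrum by (intro open_Diff finite_imp_closed) auto
    then have "(?\<rho> has_contour_integral ?I) (circlepath 0 s)"
      using path unfolding indep[OF \<open>0 < s\<close> spec, symmetric]
      by (intro has_contour_integral_integral
          contour_integrable_holomorphic_simple[OF resolvent_form_holomorphic]) auto
    moreover have "((\<lambda>z. 1 / (z - 0)) has_contour_integral 2 * of_real pi * \<i>) (circlepath 0 s)"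
      using Cauchy_integral_circlepath_simple[of "\<lambda>_. 1" 0 s 0] \<open>0 < s\<close> by simp
    ultimately have "((\<lambda>z. ?\<rho> z - 1 / (z - 0) * cinner v w)
        has_contour_integral ?I - 2 * of_real pi * \<i> * cinner v w) (circlepath 0 s)"
      by (intro has_contour_integral_diff has_contour_integral_rmul)
    then have "cmod (?I - 2 * of_real pi * \<i> * cinner v w)
        \<le> (B * norm v * norm w / (s - B) / s) * (2 * pi * s)"
    proof (rule has_contour_integral_bound_circlepath)
      show "cmod (?\<rho> z - 1 / (z - 0) * cinner v w) \<le> B * norm v * norm w / (s - B) / s"
        if "cmod (z - 0) = s" for z
      proof -
        define y where "y = matrix_inv (mat z - A) *v v"
        have "z \<notin> matrix_spectrum A"
          using that spec by auto
        then have y: "z *s y - A *v y = v"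
          unfolding y_def by (rule resolvent_inverse)
        have "s * norm y - B * norm y \<le> norm v"
          using norm_triangle_ineq2[of "z *s y" "A *v y"] B(2)[of y] that
            by (simp add: y norm_scale)
        then have "norm y \<le> norm v / (s - B)"
          using s by (simp add: field_simps)
        have "z \<noteq> 0" using that \<open>0 < s\<close> by auto
        \<comment> \<open>From \<open>z y = v + A y\<close> the error \<open>y - v / z\<close>
          equals \<open>A y / z\<close>. It is of order \<open>1 / s\<^sup>2\<close>, which
          outweighs the length of the circle.\<close>
        have "cinner y w - 1 / z * cinner v w = cinner (A *v y) w / z"
          using \<open>z \<noteq> 0\<close> unfolding y[symmetric] by (simp add: cinner_simps field_simps)
        moreover have "cmod (cinner (A *v y) w) \<le> (B * (norm v / (s - B))) * norm w"
          using B(2)[of y] mult_left_mono[OF \<open>norm y \<le> norm v / (s - B)\<close>, of B] B(1)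
          by (intro order_trans[OF cmod_cinner_le] mult_right_mono) auto
        then have "cmod (cinner (A *v y) w) / s \<le> (B * (norm v / (s - B))) * norm w / s"
          using \<open>0 < s\<close> by (intro divide_right_mono) auto
        ultimately show ?thesis
          using that unfolding y_def[symmetric] by (simp add: norm_divide)
      qed
    qed (use B s \<open>0 < s\<close> in auto)
    then show ?thesis
      using \<open>0 < s\<close> by (simp add: C_def mult_ac)
  qed
  \<comment> \<open>The left side is independent of \<open>s\<close>, so the bound may be taken to
    its limit.\<close>
  have "cmod (?I - 2 * of_real pi * \<i> * cinner v w) \<le> 0"
  proof (rule tendsto_lowerbound)
    show "((\<lambda>s. C / (s - B)) \<longlongrightarrow> 0) at_top"
      using filterlim_tendsto_add_at_top[OF tendsto_const[of "- B"] filterlim_ident]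
      by (intro real_tendsto_divide_at_top[OF tendsto_const]) simp
    show "\<forall>\<^sub>F s in at_top. cmod (?I - 2 * of_real pi * \<i> * cinner v w) \<le> C / (s - B)"
      using eventually_gt_at_top[of B] eventually_gt_at_top[of M] by eventually_elim (rule bound)
  qed simp
  then show ?thesis by simp
qed

text \<open>\<open>P u\<close> is the form of \<open>A (l u + A)\<^sup>-\<^sup>1 = I - l u (l u +
  A)\<^sup>-\<^sup>1\<close>, written with the resolvent at \<open>- l u\<close>. A double integral
  over contour and ray is evaluated in both orders.\<close>

lemma principal_power_representation:
  fixes A :: "complex^'n^'n" and x :: "complex^'n" and t \<theta> :: real
  assumes spec: "\<And>z. z \<in> matrix_spectrum A \<Longrightarrow> 0 < Re z"
    and t: "0 < t" "t < 1" and \<theta>: "\<bar>\<theta>\<bar> < pi / 2"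
  defines "l \<equiv> \<lambda>u :: real. exp (of_real u + \<i> * of_real \<theta>)"
  defines "P \<equiv> \<lambda>u. cinner x x + l u * cinner (matrix_inv (mat (- l u) - A) *v x) x"
  shows "integrable lborel (\<lambda>u. exp (of_real (t * u)) * P u)" (is ?int)
    and "of_real (power_const t) * cinner (principal_power A t *v x) x
      = exp (\<i> * of_real (t * \<theta>)) * (LBINT u. exp (of_real (t * u)) * P u)" (is ?eq)
proof -
  \<comment> \<open>The ray formula is available for \<open>0 < Re z\<close>, so the contour is
    taken inside the right half plane.\<close>
  obtain c r :: real where cr: "0 < r" "r < c" "matrix_spectrum A \<subseteq> ball (of_real c) r"
    using half_plane_circle_exists[OF finite_matrix_spectrum[of A] spec] by metis
  define \<gamma> where "\<gamma> = circlepath (of_real c) r"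
  define \<rho> where "\<rho> = (\<lambda>z. cinner (matrix_inv (mat z - A) *v x) x)"
  define H where "H = {z :: complex. 0 < Re z}"
  have H: "open H" "convex H"
    unfolding H_def by (auto intro: open_halfspace_Re_gt convex_halfspace_Re_gt)
  have Re_ge: "c - r \<le> Re z" if "cmod (z - of_real c) \<le> r" for z
    using abs_Re_le_cmod[of "z - of_real c"] that by simp
  have cball_H: "cball (of_real c) r \<subseteq> H"
    using Re_ge cr by (force simp: H_def dist_norm norm_minus_commute)
  have sphere: "path_image \<gamma> = sphere (of_real c) r"
    using cr by (simp add: \<gamma>_def)
  have path_H: "path_image \<gamma> \<subseteq> H"
    using cball_H unfolding sphere by auto
  have path_spec: "path_image \<gamma> \<inter> matrix_spectrum A = {}"
    using cr(3) unfolding sphere by auto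
  have H_slit: "H \<subseteq> - \<real>\<^sub>\<le>\<^sub>0"
    by (auto simp: H_def complex_nonpos_Reals_iff)
  have \<rho>_hol: "\<rho> holomorphic_on H - matrix_spectrum A"
    unfolding \<rho>_def by (rule resolvent_form_holomorphic)
  have open_D: "open (H - matrix_spectrum A)"
    using H(1) finite_matrix_spectrum by (intro open_Diff finite_imp_closed)
  have l_H: "- l u \<notin> H" for u
  proof -
    have "0 < cos \<theta>" using \<theta> by (intro cos_gt_zero_pi) auto
    then have "0 < exp u * cos \<theta>" by simp
    then show ?thesis by (simp add: H_def l_def Re_exp)
  qed
  have l_spec: "- l u \<notin> matrix_spectrum A" for u
    using spec[of "- l u"] l_H[of u] unfolding H_def by blast
  have power: "cinner (principal_power A t *v x) x
      = contour_integral \<gamma> (\<lambda>z. z powr of_real t * \<rho> z) / (2 * of_real pi * \<i>)"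
  proof -
    have sur: "surrounds (- \<real>\<^sub>\<le>\<^sub>0) (matrix_spectrum A) \<gamma>"
      unfolding \<gamma>_def using cr cball_H H_slit by (intro circlepath_surrounds) auto
    have hol: "(\<lambda>z. z powr of_real t) holomorphic_on - \<real>\<^sub>\<le>\<^sub>0"
      by (intro holomorphic_intros) auto
    have "matrix_spectrum A \<subseteq> - \<real>\<^sub>\<le>\<^sub>0"
      using spec H_slit by (auto simp: H_def)
    moreover have "(\<real>\<^sub>\<le>\<^sub>0 :: complex set) = of_real ` {..0}"
      by (auto simp: nonpos_Reals_def)
    then have "connected (- \<real>\<^sub>\<le>\<^sub>0 :: complex set)"
      using starlike_imp_connected[OF starlike_slotted_complex_plane_left[of 0]] by metis
    moreover have op: "open (- \<real>\<^sub>\<le>\<^sub>0 :: complex set)"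
      by (simp add: open_Compl)
    ultimately have "principal_power A t = dunford_integral \<gamma> (\<lambda>z. z powr of_real t) A"
      unfolding principal_power_def by (intro dunford_integral_unique hol sur)
    then show ?thesis
      using cinner_dunford_integral[of "- \<real>\<^sub>\<le>\<^sub>0" "\<lambda>z. z powr of_real t" \<gamma> A x x] op hol sur
      by (simp add: \<rho>_def surrounds_def)
  qed
  have inner: "contour_integral \<gamma> (\<lambda>z. z / (l u + z) * \<rho> z) = 2 * of_real pi * \<i> * P u" for u
  proof -
    define m where "m = matrix_inv (mat (- l u) - A) *v x"
    let ?\<sigma> = "\<lambda>z. cinner (matrix_inv (mat z - A) *v m) x"
    \<comment> \<open>The resolvent identity acts as a partial fraction split: two resolvent
      integrals of known value and a last term holomorphic on \<open>H\<close>.\<close>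
    have eq: "z / (l u + z) * \<rho> z = \<rho> z + l u * ?\<sigma> z - l u * cinner m x * (1 / (l u + z))"
      if "z \<in> path_image \<gamma>" for z
    proof -
      have nz: "l u + z \<noteq> 0"
        using l_H[of u] path_H that by (metis add_eq_0_iff add.commute subsetD)
      have z: "z \<notin> matrix_spectrum A" using that path_spec by auto
      have "cinner ((- l u - z) *s (matrix_inv (mat z - A) *v m)) x = \<rho> z - cinner m x"
        unfolding m_def by (simp only: resolvent_identity[OF z l_spec] cinner_simps \<rho>_def)
      then have m: "cinner m x = \<rho> z + (l u + z) * ?\<sigma> z"
        unfolding cinner_scale_left by algebra
      show ?thesis
        unfolding m using nz by (simp add: field_simps)
    qed
    have "(\<rho> has_contour_integral contour_integral \<gamma> \<rho>) \<gamma>"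
        "(?\<sigma> has_contour_integral contour_integral \<gamma> ?\<sigma>) \<gamma>"
      unfolding \<rho>_def using path_H path_spec
      by (intro has_contour_integral_integral
          contour_integrable_holomorphic_simple[OF resolvent_form_holomorphic open_D],
          auto simp: \<gamma>_def)+
    moreover have "((\<lambda>z. 1 / (l u + z)) has_contour_integral 0) \<gamma>"
    proof (rule Cauchy_theorem_convex_simple[OF _ H(2) _ path_H])
      show "(\<lambda>z. 1 / (l u + z)) holomorphic_on H"
        using l_H[of u] by (intro holomorphic_intros) (metis add_eq_0_iff add.commute)
    qed (auto simp: \<gamma>_def)
    ultimately have "((\<lambda>z. \<rho> z + l u * ?\<sigma> z - l u * cinner m x * (1 / (l u + z)))
        has_contour_integral
        contour_integral \<gamma> \<rho> + l u * contour_integral \<gamma> ?\<sigma> - l u * cinner m x * 0) \<gamma>"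
      by (intro has_contour_integral_add has_contour_integral_diff has_contour_integral_lmul)
    then have "((\<lambda>z. z / (l u + z) * \<rho> z) has_contour_integral
        contour_integral \<gamma> \<rho> + l u * contour_integral \<gamma> ?\<sigma> - l u * cinner m x * 0) \<gamma>"
      by (rule has_contour_integral_eq) (rule eq[symmetric])
    moreover have "contour_integral \<gamma> \<rho> = 2 * of_real pi * \<i> * cinner x x"
        "contour_integral \<gamma> ?\<sigma> = 2 * of_real pi * \<i> * cinner m x"
      unfolding \<rho>_def \<gamma>_def using cr by (intro contour_integral_resolvent_form; simp)+
    ultimately show ?thesis
      by (simp add: contour_integral_unique P_def m_def algebra_simps)
  qed
  \<comment> \<open>\<open>q\<close> collects the factors free of \<open>u\<close>; \<open>F\<close>
    is the integrand in both variables.\<close>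
  define q where "q = (\<lambda>s. \<gamma> s * \<rho> (\<gamma> s) * vector_derivative \<gamma> (at s))"
  define F where "F = (\<lambda>u s. exp (of_real (t * u)) / (l u + \<gamma> s) * q s)"
  have \<gamma>_cont: "continuous_on S \<gamma>" for S
    unfolding \<gamma>_def circlepath by (intro continuous_intros)
  have \<gamma>_in: "\<gamma> s \<in> path_image \<gamma>" for s
    using cr unfolding sphere by (simp add: \<gamma>_def circlepath dist_norm norm_mult)
  have "\<rho> holomorphic_on path_image \<gamma>"
    using path_H path_spec by (intro holomorphic_on_subset[OF \<rho>_hol]) auto
  then have "continuous_on S (\<lambda>s. \<rho> (\<gamma> s))" for S
    using \<gamma>_in by (intro continuous_on_compose2[OF holomorphic_on_imp_continuous_on \<gamma>_cont]) auto
  then have q_cont: "continuous_on S q" for S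
    unfolding q_def
    by (intro continuous_intros \<gamma>_cont)
      (auto simp: \<gamma>_def vector_derivative_circlepath intro!: continuous_intros)
  obtain K where K: "\<And>s. s \<in> {0..1} \<Longrightarrow> cmod (q s) \<le> K"
    using compact_imp_bounded[OF compact_continuous_image[OF q_cont[of "{0..1}"] compact_Icc]]
    unfolding bounded_iff by blast
  have Re_\<gamma>: "c - r \<le> Re (\<gamma> s)" for s
    using \<gamma>_in[of s] unfolding sphere by (intro Re_ge) (simp add: dist_norm norm_minus_commute)
  \<comment> \<open>This bound is uniform over the circle, so one multiple of
    \<open>power_kernel\<close> dominates \<open>F\<close>.\<close>
  define \<delta> where "\<delta> = min (c - r) (cos \<theta>)"
  have "0 < cos \<theta>"
    using \<theta> by (intro cos_gt_zero_pi) auto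
  then have \<delta>: "0 < \<delta>" "\<delta> \<le> Re (\<gamma> s)" "\<delta> \<le> cos \<theta>" for s
    using cr(2) Re_\<gamma>[of s] by (auto simp: \<delta>_def)
  have Re_\<gamma>_pos: "0 < Re (\<gamma> s)" for s
    using Re_\<gamma>[of s] cr by linarith
  have F_cont: "continuous_on UNIV (\<lambda>(u, s). F u s)"
    unfolding F_def case_prod_unfold l_def
    by (intro continuous_intros continuous_on_compose2[OF q_cont[of UNIV]]
        continuous_on_compose2[OF \<gamma>_cont[of UNIV]])
      (auto simp: exp_ray_plus_nonzero[OF Re_\<gamma>_pos \<theta>])
  have F_bound: "cmod (F u s) \<le> power_kernel t u / \<delta> * K" if "s \<in> {0..1}" for u s
    unfolding F_def l_def norm_mult
    by (intro mult_mono norm_exp_ray_quotient_le \<delta> K that)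
      (auto simp: power_kernel_pos less_imp_le \<delta>)
  have G: "integrable lborel (\<lambda>u. power_kernel t u / \<delta> * K)"
    using integrable_power_kernel[OF t] by simp
  \<comment> \<open>Integrating over the contour first yields the resolvent form.\<close>
  have F_int: "integral {0..1} (F u) = 2 * of_real pi * \<i> * (exp (of_real (t * u)) * P u)" for u
  proof -
    have "integral {0..1} (F u)
        = integral {0..1} (\<lambda>s. exp (of_real (t * u)) *
            (\<gamma> s / (l u + \<gamma> s) * \<rho> (\<gamma> s) * vector_derivative \<gamma> (at s)))"
      by (simp add: F_def q_def)
    also have "\<dots> = exp (of_real (t * u)) * contour_integral \<gamma> (\<lambda>z. z / (l u + z) * \<rho> z)"
      by (simp only: integral_mult_right contour_integral_integral)
    finally show ?thesis
      unfolding inner by (simp only: mult_ac)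
  qed
  have "integrable lborel (\<lambda>u. 1 / (2 * of_real pi * \<i>) *
      (2 * of_real pi * \<i> * (exp (of_real (t * u)) * P u)))"
    using fubini_Icc(1)[OF F_cont F_bound G] unfolding F_int
      by (rule Bochner_Integration.integrable_mult_right)
  then show ?int
    by (simp del: of_real_mult)
  \<comment> \<open>Integrating over the ray first restores the power of \<open>z\<close>.\<close>
  have F_line: "exp (\<i> * of_real (t * \<theta>)) * (LBINT u. F u s)
      = of_real (power_const t) * ((\<gamma> s powr of_real t * \<rho> (\<gamma> s)) * vector_derivative \<gamma> (at s))"
      for s
  proof -
    let ?L = "LBINT u. exp (of_real (t * u)) / (l u + \<gamma> s)"
    have ray: "exp (\<i> * of_real (t * \<theta>)) * (\<gamma> s * ?L)
        = \<gamma> s powr of_real t * of_real (power_const t)"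
      unfolding l_def by (rule ray_integral(2)[OF t Re_\<gamma>_pos \<theta>])
    have "(LBINT u. F u s) = ?L * q s"
      unfolding F_def by (rule integral_mult_left_zero)
    then have "exp (\<i> * of_real (t * \<theta>)) * (LBINT u. F u s)
        = (exp (\<i> * of_real (t * \<theta>)) * (\<gamma> s * ?L)) * (\<rho> (\<gamma> s) * vector_derivative \<gamma> (at s))"
      unfolding q_def by (simp only: mult_ac)
    then show ?thesis
      unfolding ray by (simp only: mult_ac)
  qed
  have "2 * of_real pi * \<i> * (exp (\<i> * of_real (t * \<theta>)) * (LBINT u. exp (of_real (t * u)) * P u))
      = exp (\<i> * of_real (t * \<theta>)) * (LBINT u. integral {0..1} (F u))"
    unfolding F_int integral_mult_right_zero by (simp only: mult_ac)
  also have "\<dots> = exp (\<i> * of_real (t * \<theta>)) * integral {0..1} (\<lambda>s. LBINT u. F u s)"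
    by (simp only: fubini_Icc(2)[OF F_cont F_bound G])
  also have "\<dots> = integral {0..1} (\<lambda>s. exp (\<i> * of_real (t * \<theta>)) * (LBINT u. F u s))"
    by (simp only: integral_mult_right)
  also have "\<dots> = of_real (power_const t) * contour_integral \<gamma> (\<lambda>z. z powr of_real t * \<rho> z)"
    by (simp only: F_line integral_mult_right contour_integral_integral)
  also have "\<dots>
      = 2 * of_real pi * \<i> * (of_real (power_const t) * cinner (principal_power A t *v x) x)"
    by (simp add: power)
  finally show ?eq
    by simp
qed

subsection \<open>Numerical range estimates\<close>

lemma form_diff_scale:
  "cinner (A *v (y - c *s v)) (y - c *s v) = cinner (A *v y) y - cnj c * cinner (A *v y) v
     - c * cinner (A *v v) y + of_real ((cmod c)\<^sup>2) * cinner (A *v v) v"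
proof -
  have "of_real ((cmod c)\<^sup>2) = c * cnj c"
    by (rule complex_norm_square)
  then show ?thesis
    by (simp only: matrix_vector_mult_diff_distrib vector_scalar_commute cinner_simps)
      (simp add: algebra_simps)
qed

lemma norm_diff_scale_power2:
  "(norm (y - c *s v))\<^sup>2 = (norm y)\<^sup>2 - 2 * Re (cnj c * cinner y v) + (cmod c)\<^sup>2 * (norm v)\<^sup>2"
proof -
  have "complex_of_real ((norm (y - c *s v))\<^sup>2)
      = cinner y y - (cnj c * cinner y v + cnj (cnj c * cinner y v)) + (c * cnj c) * cinner v v"
    unfolding cinner_self[symmetric]
    by (simp add: cinner_simps cinner_commute[of v y] algebra_simps)
  also have "\<dots> = of_real ((norm y)\<^sup>2 - 2 * Re (cnj c * cinner y v) + (cmod c)\<^sup>2 * (norm v)\<^sup>2)"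
    by (simp only: cinner_self complex_add_cnj complex_norm_square[symmetric] of_real_add
        of_real_diff of_real_mult)
  finally show ?thesis
    by (simp only: of_real_eq_iff)
qed

lemma unit_vector_exists: "\<exists>e :: complex^'n. norm e = 1"
  using numerical_radius_attained by blast

lemma unit_direction:
  fixes v :: "complex^'n"
  obtains e where "norm e = 1" "v = of_real (norm v) *s e"
proof (cases "v = 0")
  case True
  then show thesis using unit_vector_exists that by auto
next
  case False
  have "norm (of_real (1 / norm v) *s v) = 1"
    using False by (simp add: norm_scale norm_divide)
  moreover have "v = of_real (norm v) *s (of_real (1 / norm v) *s v)"
    using False by (simp add: vec_eq_iff)
  ultimately show thesis by (rule that)
qed

lemma form_scale:
  "cinner (A *v (of_real s *s e)) (of_real s *s e)
    = of_real (s\<^sup>2) * cinner (A *v e) e"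
  by (simp add: vector_scalar_commute cinner_simps power2_eq_square)

lemma form_norm_le: "cmod (cinner (A *v v) v) \<le> numerical_radius A * (norm v)\<^sup>2"
proof -
  obtain e where e: "norm e = 1" "v = of_real (norm v) *s e"
    by (rule unit_direction)
  have "cinner (A *v v) v = of_real ((norm v)\<^sup>2) * cinner (A *v e) e"
    using form_scale[of A "norm v" e] e(2) by metis
  moreover have "cmod (cinner (A *v e) e) \<le> numerical_radius A"
    using numerical_radius_attained[of A] e(1) by metis
  ultimately show ?thesis
    by (simp add: norm_mult norm_power mult.commute[of "(norm v)\<^sup>2"] mult_right_mono)
qed

lemma accretive_form_pos:
  assumes "accretive A" "v \<noteq> 0"
  shows "0 < Re (cinner (A *v v) v)"
  using assms by (auto simp: accretive_def positive_definite_def Re_cinner_real_part)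

lemma accretive_form_nonneg:
  assumes "accretive A"
  shows "0 \<le> Re (cinner (A *v v) v)"
  using accretive_form_pos[OF assms, of v] by (cases "v = 0") (auto simp: less_imp_le)

lemma sectorial_form:
  assumes "A \<in> sectorial \<alpha>"
  shows "\<bar>Im (cinner (A *v v) v)\<bar> \<le> tan \<alpha> * Re (cinner (A *v v) v)"
proof -
  obtain e where e: "norm e = 1" "v = of_real (norm v) *s e"
    by (rule unit_direction)
  have eq: "cinner (A *v v) v = of_real ((norm v)\<^sup>2) * cinner (A *v e) e"
    using form_scale[of A "norm v" e] e(2) by metis
  have "\<bar>Im (cinner (A *v e) e)\<bar> \<le> tan \<alpha> * Re (cinner (A *v e) e)"
    using assms e(1) by (auto simp: sectorial_def numerical_range_def sector_def)
  then have "(norm v)\<^sup>2 * \<bar>Im (cinner (A *v e) e)\<bar> \<le> (norm v)\<^sup>2 * (tan \<alpha> * Re (cinner (A *v e) e))"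
    by (intro mult_left_mono) auto
  then show ?thesis
    unfolding eq by (simp add: abs_mult mult_ac)
qed

text \<open>Square the sector bound, add \<open>(cos \<beta> * Re z)\<^sup>2\<close> and use the
  Pythagorean identity. This is how a sector lets the real part control the modulus.\<close>

lemma tan_bound_imp_cos_cmod_le:
  assumes "\<bar>\<beta>\<bar> < pi / 2" "\<bar>Im z\<bar> * cos \<beta> \<le> sin \<beta> * Re z" "0 \<le> Re z"
  shows "cos \<beta> * cmod z \<le> Re z"
proof -
  have "0 < cos \<beta>" using assms(1) by (intro cos_gt_zero_pi) auto
  have "(\<bar>Im z\<bar> * cos \<beta>)\<^sup>2 \<le> (sin \<beta> * Re z)\<^sup>2"
    using assms(2) \<open>0 < cos \<beta>\<close> by (intro power_mono) auto
  then have "(cos \<beta>)\<^sup>2 * (Im z)\<^sup>2 \<le> (sin \<beta>)\<^sup>2 * (Re z)\<^sup>2"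
    by (simp add: power_mult_distrib mult.commute)
  then have "(cos \<beta> * cmod z)\<^sup>2 \<le> ((cos \<beta>)\<^sup>2 + (sin \<beta>)\<^sup>2) * (Re z)\<^sup>2"
    unfolding power_mult_distrib cmod_power2 by (simp only: distrib_left distrib_right)
  then have "(cos \<beta> * cmod z)\<^sup>2 \<le> (Re z)\<^sup>2"
    by simp
  then show ?thesis
    using assms(3) by (rule power2_le_imp_le)
qed

text \<open>
  Add the nonnegative values of the real parts of \<open>e\<^sup>i\<^sup>\<beta> A\<close> and \<open>e\<^sup>-\<^sup>i\<^sup>\<beta> A\<close>, \<open>\<beta> = pi / 2 - \<alpha>\<close>, at
  \<open>y - s e\<^sup>i\<^sup>\<alpha> A y\<close> and \<open>y - s e\<^sup>-\<^sup>i\<^sup>\<alpha> A y\<close>: the phases make the unwanted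
  mixed terms \<open>\<langle>A (A y), y\<rangle>\<close> cancel.
\<close>

lemma sectorial_image_norm_le_pos:
  fixes A :: "complex^'n^'n"
  assumes \<alpha>: "0 < \<alpha>" "\<alpha> < pi / 2" and "0 < w"
    and sec: "\<And>v. \<bar>Im (cinner (A *v v) v)\<bar> \<le> tan \<alpha> * Re (cinner (A *v v) v)"
    and w: "\<And>v. Re (cinner (A *v v) v) \<le> w * (norm v)\<^sup>2"
  shows "(cos \<alpha>)\<^sup>2 * (norm (A *v y))\<^sup>2 \<le> w * Re (cinner (A *v y) y)"
proof -
  let ?C = "cos \<alpha>" and ?S = "sin \<alpha>"
  have C: "0 < ?C" using \<alpha> by (intro cos_gt_zero_pi) auto
  have S: "0 < ?S" using \<alpha> by (intro sin_gt_zero) auto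
  have sec': "\<bar>?C * Im (cinner (A *v v) v)\<bar> \<le> ?S * Re (cinner (A *v v) v)" for v
    using mult_left_mono[OF sec[of v], of ?C] C by (simp add: tan_def abs_mult)
  define v where "v = A *v y"
  \<comment> \<open>This value maximizes \<open>2 * s * ?C * p - s\<^sup>2 * w * p\<close>, the
    lower bound for \<open>Re a\<close> reached below.\<close>
  define s where "s = ?C / w"
  define p where "p = (norm v)\<^sup>2"
  define q where "q = cinner (A *v v) y"
  define a where "a = cinner (A *v y) y"
  define d where "d = cinner (A *v v) v"
  have p: "cinner (A *v y) v = of_real p"
    by (simp add: v_def p_def cinner_self)
  have "0 \<le> s" using C \<open>0 < w\<close> by (simp add: s_def)
  have expand: "cinner (A *v (y - (of_real s * cis \<beta>) *s v)) (y - (of_real s * cis \<beta>) *s v)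
      = a - of_real s * cis (- \<beta>) * of_real p - of_real s * cis \<beta> * q + of_real (s\<^sup>2) * d" for \<beta>
    unfolding form_diff_scale p a_def d_def q_def
    by (simp add: norm_mult cis_cnj)
  have "0 \<le> ?S * (Re a - s * ?C * p - s * (?C * Re q - ?S * Im q) + s\<^sup>2 * Re d)
      - ?C * (Im a + s * ?S * p - s * (?C * Im q + ?S * Re q) + s\<^sup>2 * Im d)"
    using sec'[of "y - (of_real s * cis \<alpha>) *s v"] unfolding expand by (simp add: algebra_simps)
  moreover have "0 \<le> ?S * (Re a - s * ?C * p - s * (?C * Re q + ?S * Im q) + s\<^sup>2 * Re d)
      + ?C * (Im a - s * ?S * p - s * (?C * Im q - ?S * Re q) + s\<^sup>2 * Im d)"
    using sec'[of "y - (of_real s * cis (- \<alpha>)) *s v"] unfolding expand by (simp add: algebra_simps)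
  ultimately have "0 \<le> (2 * ?S) * (Re a + s\<^sup>2 * Re d - 2 * s * ?C * p)"
    by (simp add: algebra_simps)
  then have "0 \<le> Re a + s\<^sup>2 * Re d - 2 * s * ?C * p"
    using S by (simp add: zero_le_mult_iff)
  moreover have "s\<^sup>2 * Re d \<le> s\<^sup>2 * (w * p)"
    using w[of v] by (intro mult_left_mono) (auto simp: d_def p_def)
  moreover have "s\<^sup>2 * (w * p) = s * ?C * p"
    using \<open>0 < w\<close> by (simp add: s_def power2_eq_square)
  ultimately have "s * ?C * p \<le> Re a"
    by linarith
  then have "w * (s * ?C * p) \<le> w * Re a"
    using \<open>0 < w\<close> by simp
  then show ?thesis
    using \<open>0 < w\<close> by (simp add: s_def p_def v_def a_def power2_eq_square)
qed

lemma sectorial_image_norm_le: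
  fixes A :: "complex^'n^'n"
  assumes "accretive A" "A \<in> sectorial \<alpha>" "0 \<le> \<alpha>" "\<alpha> < pi / 2" "0 < w"
    and w: "\<And>v. Re (cinner (A *v v) v) \<le> w * (norm v)\<^sup>2"
  shows "(cos \<alpha>)\<^sup>2 * (norm (A *v y))\<^sup>2 \<le> w * Re (cinner (A *v y) y)"
proof (cases "\<alpha> = 0")
  case False
  then show ?thesis
    using assms by (intro sectorial_image_norm_le_pos sectorial_form) auto
next
  case True
  have bound: "(cos \<beta>)\<^sup>2 * (norm (A *v y))\<^sup>2
      \<le> w * Re (cinner (A *v y) y)"
    if "0 < \<beta>" "\<beta> < pi / 2" for \<beta>
  proof (rule sectorial_image_norm_le_pos[OF that \<open>0 < w\<close> _ w])
    fix v
    have "0 \<le> tan \<beta> * Re (cinner (A *v v) v)"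
      using that accretive_form_nonneg[OF assms(1), of v]
        by (intro mult_nonneg_nonneg) (auto simp: tan_gt_zero less_imp_le)
    then show "\<bar>Im (cinner (A *v v) v)\<bar> \<le> tan \<beta> * Re (cinner (A *v v) v)"
      using sectorial_form[OF assms(2), of v] True by simp
  qed
  have "((\<lambda>\<beta>. (cos \<beta>)\<^sup>2 * (norm (A *v y))\<^sup>2) \<longlongrightarrow> (cos 0)\<^sup>2 * (norm (A *v y))\<^sup>2) (at_right 0)"
    by (intro tendsto_intros)
  moreover have "\<forall>\<^sub>F \<beta> in at_right 0. (cos \<beta>)\<^sup>2 * (norm (A *v y))\<^sup>2 \<le> w * Re (cinner (A *v y) y)"
    unfolding eventually_at_right_field using bound pi_gt_zero by (intro exI[of _ "pi / 2"]) auto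
  ultimately show ?thesis
    using True by (intro tendsto_upperbound) auto
qed

section \<open>Bounds for resolvent forms on the positive ray\<close>

lemma resolvent_form_eq:
  assumes "- l \<notin> matrix_spectrum A"
  obtains y where "x = l *s y + A *v y"
    and "cinner x x + l * cinner (matrix_inv (mat (- l) - A) *v x) x = cinner (A *v y) x"
proof
  \<comment> \<open>The witness for \<open>y\<close> is \<open>- ?m\<close>, that is
    \<open>(l + A)\<^sup>-\<^sup>1 x\<close>; then \<open>A y = x - l y\<close>.\<close>
  let ?m = "matrix_inv (mat (- l) - A) *v x"
  have "(- l) *s ?m - A *v ?m = x"
    by (rule resolvent_inverse(1)[OF assms])
  moreover have "A *v (- ?m) = - (A *v ?m)"
    using matrix_vector_mult_diff_distrib[of A 0 ?m] by simp
  moreover have "l *s (- ?m) = (- l) *s ?m"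
    by (simp add: vec_eq_iff)
  ultimately show x: "x = l *s (- ?m) + A *v (- ?m)"
    by (simp only: diff_conv_add_uminus)
  have "A *v (- ?m) = x - l *s (- ?m)"
    using x by (metis add_diff_cancel_left')
  then show "cinner x x + l * cinner ?m x = cinner (A *v (- ?m)) x"
    by (simp only: cinner_simps cinner_minus_left) simp
qed

lemma form_of_sum:
  assumes "x = l *s y + A *v y"
  shows "cinner (A *v y) x = cnj l * cinner (A *v y) y + of_real ((norm (A *v y))\<^sup>2)"
    and "(norm x)\<^sup>2
        = (cmod l)\<^sup>2 * (norm y)\<^sup>2 + 2 * Re (cnj l * cinner (A *v y) y) + (norm (A *v y))\<^sup>2"
proof -
  show "cinner (A *v y) x = cnj l * cinner (A *v y) y + of_real ((norm (A *v y))\<^sup>2)"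
    unfolding assms by (simp only: cinner_simps cinner_self)
  have "x = A *v y - (- l) *s y"
    unfolding assms by (simp add: vec_eq_iff)
  then show "(norm x)\<^sup>2
      = (cmod l)\<^sup>2 * (norm y)\<^sup>2 + 2 * Re (cnj l * cinner (A *v y) y) + (norm (A *v y))\<^sup>2"
    using norm_diff_scale_power2[of "A *v y" "- l" y] by simp
qed

lemma resolvent_form_upper:
  fixes l H :: real
  assumes "0 < l" "0 < H" and x: "x = of_real l *s y + A *v y" "norm x = 1"
    and le: "Re (cinner (A *v y) y) \<le> H * (norm y)\<^sup>2"
      "(norm (A *v y))\<^sup>2 \<le> H * Re (cinner (A *v y) y)"
  shows "Re (cinner (A *v y) x) \<le> H / (l + H)"
proof -
  define a where "a = Re (cinner (A *v y) y)"
  define p where "p = (norm (A *v y))\<^sup>2"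
  define q where "q = (norm y)\<^sup>2"
  have P: "Re (cinner (A *v y) x) = l * a + p"
    using form_of_sum(1)[OF x(1)] by (simp add: a_def p_def)
  have one: "l\<^sup>2 * q + 2 * (l * a) + p = 1"
    using form_of_sum(2)[OF x(1)] x(2) by (simp add: a_def p_def q_def)
  \<comment> \<open>This is \<open>(l + H) * (l * a + p)\<close> minus \<open>H\<close> times the
    expansion of \<open>(norm x)\<^sup>2\<close>, so the normalization of \<open>x\<close> makes the
    bound homogeneous.\<close>
  have "l * (l * (a - H * q) + (p - H * a)) \<le> 0"
    using le assms(1) by (intro mult_nonneg_nonpos add_nonpos_nonpos) (auto simp: a_def p_def q_def)
  then have "(l + H) * (l * a + p) \<le> H * (l\<^sup>2 * q + 2 * (l * a) + p)"
    by (simp add: algebra_simps power2_eq_square)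
  then show ?thesis
    using assms(1,2) unfolding P one by (simp add: pos_le_divide_eq mult.commute)
qed

lemma linear_coefficient_zero:
  fixes b c :: real
  assumes "\<And>e. e * b + e\<^sup>2 * c \<le> 0"
  shows "b = 0"
proof (rule ccontr)
  assume "b \<noteq> 0"
  \<comment> \<open>Since \<open>k > \<bar>c\<bar>\<close>, the linear term outweighs the quadratic
    one at \<open>e = b / k\<close>.\<close>
  define k where "k = 1 + \<bar>c\<bar>"
  have k: "0 < k" "- k + 1 \<le> c" by (auto simp: k_def)
  have "(b / k) * b + (b / k)\<^sup>2 * c = (b / k)\<^sup>2 * (k + c)"
    using k by (simp add: field_simps power2_eq_square)
  moreover have "0 < (b / k)\<^sup>2 * (k + c)"
    using k \<open>b \<noteq> 0\<close> by (intro mult_pos_pos) auto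
  ultimately show False
    using assms[of "b / k"] by simp
qed

text \<open>
  The first variation at the maximizer \<open>x\<close> makes it an eigenvector of the real part of \<open>A\<close> for the
  eigenvalue \<open>h\<close>.
\<close>

lemma resolvent_form_lower:
  fixes l h :: real
  assumes "0 < l" "0 < h" and x: "x = of_real l *s y + A *v y" "norm x = 1"
    and nonneg: "\<And>v. 0 \<le> Re (cinner (A *v v) v)"
    and h: "Re (cinner (A *v x) x) = h" "\<And>v. Re (cinner (A *v v) v) \<le> h * (norm v)\<^sup>2"
  shows "h / (l + h) \<le> Re (cinner (A *v y) x)"
proof -
  define q where "q = Re (cinner y x)"
  define b where "b = Re (cinner (A *v y) x) + Re (cinner (A *v x) y)"
  \<comment> \<open>Maximality is tested at \<open>x - e y\<close>; the constant terms cancel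
    because \<open>x\<close> is a unit vector with value \<open>h\<close>.\<close>
  have "e * (2 * h * q - b) + e\<^sup>2 * (Re (cinner (A *v y) y) - h * (norm y)\<^sup>2) \<le> 0" for e :: real
  proof -
    have "Re (cinner (A *v (x - of_real e *s y)) (x - of_real e *s y))
        \<le> h * (norm (x - of_real e *s y))\<^sup>2"
      by (rule h(2))
    moreover have "Re (cinner x y) = q"
      by (simp add: q_def cinner_commute[of y x])
    ultimately show ?thesis
      unfolding form_diff_scale norm_diff_scale_power2
      using x(2) h(1) by (simp add: b_def algebra_simps)
  qed
  \<comment> \<open>This is the eigenvector equation tested against \<open>y\<close>.\<close>
  from linear_coefficient_zero[OF this] have b: "b = 2 * h * q"
    by simp
  \<comment> \<open>This reduces the claim to \<open>q \<le> 1 / (l + h)\<close>.\<close>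
  have P: "Re (cinner (A *v y) x) = 1 - l * q"
  proof -
    have "A *v y = x - of_real l *s y"
      using x(1) by simp
    then have "cinner (A *v y) x = of_real ((norm x)\<^sup>2) - of_real l * cinner y x"
      by (simp only: cinner_simps cinner_self)
    then show ?thesis by (simp add: x(2) q_def)
  qed
  have yq: "l * (norm y)\<^sup>2 + Re (cinner (A *v y) y) = q"
  proof -
    have "cinner x y = of_real l * of_real ((norm y)\<^sup>2) + cinner (A *v y) y"
      by (subst x(1)) (simp only: cinner_simps cinner_self)
    then have "Re (cinner x y) = l * (norm y)\<^sup>2 + Re (cinner (A *v y) y)"
      by simp
    then show ?thesis
      by (simp add: q_def cinner_commute[of y x])
  qed
  \<comment> \<open>With \<open>R\<close> the real part of \<open>A\<close>, the vector
    \<open>e x\<close> is \<open>(l + R)\<^sup>-\<^sup>1 x\<close>. The nonnegative form of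
    \<open>l + R\<close> at \<open>y - e x\<close> comes out as \<open>e - q\<close>.\<close>
  define e where "e = 1 / (l + h)"
  have e: "e * (l + h) = 1"
    using assms(1,2) by (simp add: e_def)
  let ?v = "y - of_real e *s x"
  have "0 \<le> l * (norm ?v)\<^sup>2 + Re (cinner (A *v ?v) ?v)"
    using nonneg[of ?v] assms(1) by simp
  also have "\<dots>
      = (l * (norm y)\<^sup>2 + Re (cinner (A *v y) y)) - e * (2 * l * q + b) + e * (e * (l + h))"
    unfolding form_diff_scale norm_diff_scale_power2
    using x(2) h(1) by (simp add: b_def q_def algebra_simps power2_eq_square)
  also have "\<dots> = q - 2 * (e * (l + h)) * q + e"
    unfolding yq b using e by algebra
  also have "\<dots> = e - q"
    by (simp add: e)
  finally have "l * q \<le> l * e"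
    using assms(1) by simp
  moreover have "h / (l + h) = 1 - l * e"
    using assms(1,2) by (simp add: e_def field_simps)
  ultimately show ?thesis
    unfolding P by simp
qed

section \<open>From pointwise resolvent bounds to the power\<close>

lemma real_kernel_integral:
  assumes t: "0 < t" "t < 1" and "0 < H"
  shows "integrable lborel (\<lambda>u. exp (t * u) * (H / (exp u + H)))"
    and "(LBINT u. exp (t * u) * (H / (exp u + H))) = H powr t * power_const t"
proof -
  have pi2: "\<bar>0 :: real\<bar> < pi / 2" by simp
  have Re_H: "0 < Re (of_real H)" using assms(3) by simp
  have eq: "exp (of_real (t * u)) / (exp (of_real u + \<i> * of_real 0) + of_real H)
      = complex_of_real (exp (t * u) / (exp u + H))" for u
    by (simp add: exp_of_real flip: of_real_mult)
  have int: "integrable lborel (\<lambda>u. exp (t * u) / (exp u + H))"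
    using ray_integral(1)[OF t Re_H pi2] unfolding eq complex_of_real_integrable_eq .
  then show "integrable lborel (\<lambda>u. exp (t * u) * (H / (exp u + H)))"
    using Bochner_Integration.integrable_mult_right[of H, OF int] by (simp add: mult_ac)
  have "complex_of_real (H * (LBINT u. exp (t * u) / (exp u + H)))
      = of_real (H powr t * power_const t)"
    using ray_integral(2)[OF t Re_H pi2] assms(3) unfolding eq integral_complex_of_real
    by (simp add: powr_of_real)
  then have "H * (LBINT u. exp (t * u) / (exp u + H)) = H powr t * power_const t"
    by (simp only: of_real_eq_iff)
  moreover have "(LBINT u. exp (t * u) * (H / (exp u + H)))
      = (LBINT u. H * (exp (t * u) / (exp u + H)))"
    by (simp add: mult_ac)
  ultimately show "(LBINT u. exp (t * u) * (H / (exp u + H))) = H powr t * power_const t"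
    by (simp only: integral_mult_right_zero)
qed

text \<open>The phase stands on the side of the power, so real and imaginary parts can be taken
  under an integral with positive weight.\<close>

lemma principal_power_form_integral:
  fixes A :: "complex^'n^'n" and x :: "complex^'n" and t \<theta> :: real
  assumes "accretive A" and t: "0 < t" "t < 1" and \<theta>: "\<bar>\<theta>\<bar> < pi / 2"
  obtains f where "\<And>u. \<exists>y. x = exp (of_real u + \<i> * of_real \<theta>) *s y + A *v y
      \<and> f u = cinner (A *v y) x"
    and "integrable lborel (\<lambda>u. of_real (exp (t * u)) * f u)"
    and "of_real (power_const t) * (cis (- (t * \<theta>)) * cinner (principal_power A t *v x) x)
      = (LBINT u. of_real (exp (t * u)) * f u)"
proof -
  define l where "l = (\<lambda>u :: real. exp (of_real u + \<i> * of_real \<theta>))"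
  define f where "f = (\<lambda>u. cinner x x + l u * cinner (matrix_inv (mat (- l u) - A) *v x) x)"
  have spec: "\<And>z. z \<in> matrix_spectrum A \<Longrightarrow> 0 < Re z"
    using accretive_spectrum[OF assms(1)] .
  have "- l u \<notin> matrix_spectrum A" for u
  proof -
    have "0 < cos \<theta>" using \<theta> by (intro cos_gt_zero_pi) auto
    then have "Re (- l u) \<le> 0" by (simp add: l_def Re_exp)
    then show ?thesis using spec[of "- l u"] by linarith
  qed
  then have "\<exists>y. x = l u *s y + A *v y \<and> f u = cinner (A *v y) x" for u
    unfolding f_def by (metis resolvent_form_eq)
  moreover have "integrable lborel (\<lambda>u. of_real (exp (t * u)) * f u)"
    using principal_power_representation(1)[where A = A and x = x, OF spec t \<theta>]
      by (simp add: f_def l_def flip: exp_of_real)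
  moreover have "of_real (power_const t) * (cis (- (t * \<theta>)) * cinner (principal_power A t *v x) x)
      = (LBINT u. of_real (exp (t * u)) * f u)"
  proof -
    have "of_real (power_const t) * cinner (principal_power A t *v x) x
        = cis (t * \<theta>) * (LBINT u. of_real (exp (t * u)) * f u)"
      using principal_power_representation(2)[where A = A and x = x, OF spec t \<theta>]
        by (simp add: f_def l_def cis_conv_exp flip: exp_of_real)
    then have "cis (- (t * \<theta>)) * (of_real (power_const t) * cinner (principal_power A t *v x) x)
        = (cis (- (t * \<theta>)) * cis (t * \<theta>)) * (LBINT u. of_real (exp (t * u)) * f u)"
      by (simp only: mult.assoc)
    then show ?thesis
      by (simp add: cis_mult mult_ac)
  qed
  ultimately show thesis
    unfolding l_def by (rule that)
qed

text \<open>Pointwise comparison on the ray \<open>\<theta> = 0\<close> is integrated against a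
  positive weight, and \<open>power_const t\<close> is cancelled. The hypotheses range over all
  \<open>l\<close> and \<open>y\<close> because the resolvent vector is known only through
  \<open>x = l y + A y\<close>.\<close>

lemma Re_principal_power_bounds:
  fixes A :: "complex^'n^'n"
  assumes "accretive A" and t: "0 < t" "t < 1"
  shows "0 \<le> Re (cinner (principal_power A t *v x) x)"
    and "0 < H \<Longrightarrow> (\<And>l y. 0 < l \<Longrightarrow> x = of_real l *s y + A *v y \<Longrightarrow> Re (cinner (A *v y) x) \<le> H / (l + H))
      \<Longrightarrow> Re (cinner (principal_power A t *v x) x) \<le> H powr t"
    and "0 < H \<Longrightarrow> (\<And>l y. 0 < l \<Longrightarrow> x = of_real l *s y + A *v y \<Longrightarrow> H / (l + H) \<le> Re (cinner (A *v y) x))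
      \<Longrightarrow> H powr t \<le> Re (cinner (principal_power A t *v x) x)"
proof -
  let ?B = "Re (cinner (principal_power A t *v x) x)"
  have pi2: "\<bar>0 :: real\<bar> < pi / 2" by simp
  obtain f where f0: "\<And>u. \<exists>y. x = exp (of_real u + \<i> * of_real 0) *s y + A *v y
      \<and> f u = cinner (A *v y) x"
    and int: "integrable lborel (\<lambda>u. of_real (exp (t * u)) * f u)"
    and eq0: "of_real (power_const t) * (cis (- (t * 0)) * cinner (principal_power A t *v x) x)
      = (LBINT u. of_real (exp (t * u)) * f u)"
    using principal_power_form_integral[OF assms(1) t pi2, where x = x] by blast
  have f: "\<exists>y. x = of_real (exp u) *s y + A *v y \<and> f u = cinner (A *v y) x" for u
    using f0[of u] by (simp add: exp_of_real)
  have eq: "of_real (power_const t) * cinner (principal_power A t *v x) x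
      = (LBINT u. of_real (exp (t * u)) * f u)"
    using eq0 by simp
  have int_Re: "integrable lborel (\<lambda>u. exp (t * u) * Re (f u))"
    using integrable_Re[OF int] by simp
  have B: "power_const t * ?B = (LBINT u. exp (t * u) * Re (f u))"
    using arg_cong[OF eq, of Re] integral_Re[OF int] by simp
  note J = power_const_pos[OF t]
  have "0 \<le> Re (f u)" for u
  proof -
    obtain y where y: "x = of_real (exp u) *s y + A *v y" "f u = cinner (A *v y) x"
      using f by blast
    show ?thesis
      unfolding y(2) form_of_sum(1)[OF y(1)] using accretive_form_nonneg[OF assms(1), of y] by simp
  qed
  then have "0 \<le> power_const t * ?B"
    unfolding B by (intro Bochner_Integration.integral_nonneg) simp
  then show "0 \<le> ?B"
    using J by (simp add: zero_le_mult_iff)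
  show "?B \<le> H powr t" if "0 < H"
    and le: "\<And>l y. 0 < l \<Longrightarrow> x = of_real l *s y + A *v y \<Longrightarrow> Re (cinner (A *v y) x) \<le> H / (l + H)"
  proof -
    have "Re (f u) \<le> H / (exp u + H)" for u
      using f[of u] le[of "exp u"] by auto
    then have "power_const t * ?B \<le> H powr t * power_const t"
      unfolding B real_kernel_integral(2)[OF t \<open>0 < H\<close>, symmetric]
      by (intro Bochner_Integration.integral_mono int_Re real_kernel_integral(1)[OF t \<open>0 < H\<close>]
          mult_left_mono) auto
    then show ?thesis using J by (simp add: mult.commute)
  qed
  show "H powr t \<le> ?B" if "0 < H"
    and le: "\<And>l y. 0 < l \<Longrightarrow> x = of_real l *s y + A *v y \<Longrightarrow> H / (l + H) \<le> Re (cinner (A *v y) x)"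
  proof -
    have "H / (exp u + H) \<le> Re (f u)" for u
      using f[of u] le[of "exp u"] by auto
    then have "H powr t * power_const t \<le> power_const t * ?B"
      unfolding B real_kernel_integral(2)[OF t \<open>0 < H\<close>, symmetric]
      by (intro Bochner_Integration.integral_mono int_Re real_kernel_integral(1)[OF t \<open>0 < H\<close>]
          mult_left_mono) auto
    then show ?thesis using J by (simp add: mult.commute)
  qed
qed

text \<open>In \<open>cnj l * \<langle>A y, y\<rangle> + (norm (A y))\<^sup>2\<close> the second
  term is real, so on the ray the imaginary part has the sign of that of the form rotated by
  \<open>- \<theta>\<close>. The sign of \<open>s\<close> selects the half plane.\<close>

lemma Im_rotated_principal_power:
  fixes A :: "complex^'n^'n"
  assumes "accretive A" and t: "0 < t" "t < 1" and \<theta>: "\<bar>\<theta>\<bar> < pi / 2"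
    and le: "\<And>y. s * Im (cis (- \<theta>) * cinner (A *v y) y) \<le> 0"
  shows "s * Im (cis (- (t * \<theta>)) * cinner (principal_power A t *v x) x) \<le> 0"
proof -
  let ?B = "Im (cis (- (t * \<theta>)) * cinner (principal_power A t *v x) x)"
  obtain f where f: "\<And>u. \<exists>y. x = exp (of_real u + \<i> * of_real \<theta>) *s y + A *v y
      \<and> f u = cinner (A *v y) x"
    and int: "integrable lborel (\<lambda>u. of_real (exp (t * u)) * f u)"
    and eq: "of_real (power_const t) * (cis (- (t * \<theta>)) * cinner (principal_power A t *v x) x)
        = (LBINT u. of_real (exp (t * u)) * f u)"
    using principal_power_form_integral[OF assms(1) t \<theta>, where x = x] by blast
  have "s * Im (f u) \<le> 0" for u
  proof -
    obtain y where y: "x = exp (of_real u + \<i> * of_real \<theta>) *s y + A *v y" "f u = cinner (A *v y) x"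
      using f by blast
    have "cnj (exp (of_real u + \<i> * of_real \<theta>)) = of_real (exp u) * cis (- \<theta>)"
      by (simp add: exp_add exp_of_real cis_conv_exp exp_cnj)
    then have "s * Im (f u) = exp u * (s * Im (cis (- \<theta>) * cinner (A *v y) y))"
      unfolding y(2) form_of_sum(1)[OF y(1)] by (simp add: algebra_simps)
    then show ?thesis
      using mult_nonneg_nonpos[OF exp_ge_zero[of u] le[of y]] by linarith
  qed
  then have "0 \<le> (LBINT u. exp (t * u) * (- (s * Im (f u))))"
    by (intro Bochner_Integration.integral_nonneg mult_nonneg_nonneg) auto
  also have "\<dots> = (LBINT u. - s * Im (of_real (exp (t * u)) * f u))"
    by (simp add: mult_ac)
  also have "\<dots> = - s * Im (LBINT u. of_real (exp (t * u)) * f u)"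
    by (simp only: integral_mult_right_zero integral_Im[OF int])
  also have "\<dots> = - (power_const t * (s * ?B))"
    unfolding eq[symmetric] by simp
  finally show ?thesis
    using power_const_pos[OF t] by (simp add: mult_le_0_iff)
qed

text \<open>A sector is the intersection of two half planes, and the rays at \<open>\<alpha>\<close>
  and \<open>- \<alpha>\<close> give one each. The denominator \<open>cos (t * \<alpha>)\<close> is
  cleared to suit \<open>tan_bound_imp_cos_cmod_le\<close>.\<close>

lemma principal_power_sectorial:
  fixes A :: "complex^'n^'n"
  assumes "accretive A" "A \<in> sectorial \<alpha>" "0 \<le> \<alpha>" "\<alpha> < pi / 2" and t: "0 < t" "t < 1"
  shows "\<bar>Im (cinner (principal_power A t *v x) x)\<bar> * cos (t * \<alpha>)
      \<le> sin (t * \<alpha>) * Re (cinner (principal_power A t *v x) x)"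
proof -
  have C: "0 < cos \<alpha>" using assms(3,4) by (intro cos_gt_zero_pi) auto
  have sec: "\<bar>cos \<alpha> * Im (cinner (A *v y) y)\<bar> \<le> sin \<alpha> * Re (cinner (A *v y) y)" for y
    using mult_left_mono[OF sectorial_form[OF assms(2), of y], of "cos \<alpha>"] C
      by (simp add: tan_def abs_mult)
  have "1 * Im (cis (- (t * \<alpha>)) * cinner (principal_power A t *v x) x) \<le> 0"
  proof (rule Im_rotated_principal_power[OF assms(1) t])
    show "1 * Im (cis (- \<alpha>) * cinner (A *v y) y) \<le> 0" for y
      using sec[of y] by (simp add: abs_le_iff)
  qed (use assms(3,4) in simp)
  moreover have "(- 1) * Im (cis (- (t * (- \<alpha>))) * cinner (principal_power A t *v x) x) \<le> 0"
  proof (rule Im_rotated_principal_power[OF assms(1) t])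
    show "(- 1) * Im (cis (- (- \<alpha>)) * cinner (A *v y) y) \<le> 0" for y
      using sec[of y] by (simp add: abs_le_iff)
  qed (use assms(3,4) in simp)
  moreover have "0 < cos (t * \<alpha>)"
  proof -
    have "0 \<le> t * \<alpha>" "t * \<alpha> \<le> 1 * \<alpha>"
      using assms(3) t mult_right_mono[of t 1 \<alpha>] by simp_all
    then show ?thesis using assms(4) by (intro cos_gt_zero_pi) auto
  qed
  ultimately have "\<bar>Im (cinner (principal_power A t *v x) x) * cos (t * \<alpha>)\<bar>
      \<le> sin (t * \<alpha>) * Re (cinner (principal_power A t *v x) x)"
    by (simp add: abs_le_iff algebra_simps)
  then show ?thesis
    using \<open>0 < cos (t * \<alpha>)\<close> by (simp add: abs_mult)
qed

section \<open>The two inequalities\<close>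

lemma Re_form_attains_max:
  fixes A :: "complex^'n^'n"
  obtains x where "norm x = 1" "\<And>v. Re (cinner (A *v v) v) \<le> Re (cinner (A *v x) x) * (norm v)\<^sup>2"
proof -
  have cont: "continuous_on (sphere 0 1) (\<lambda>x :: complex^'n. Re (cinner (A *v x) x))"
    unfolding cinner_def matrix_vector_mult_def vec_lambda_beta by (intro continuous_intros)
  have "sphere 0 1 \<noteq> ({} :: (complex^'n) set)"
    using unit_vector_exists by force
  from continuous_attains_sup[OF compact_sphere this cont]
  obtain x where x: "norm x = 1" "\<And>e. norm e = 1 \<Longrightarrow> Re (cinner (A *v e) e) \<le> Re (cinner (A *v x) x)"
    by auto
  have "Re (cinner (A *v v) v) \<le> Re (cinner (A *v x) x) * (norm v)\<^sup>2" for v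
  proof -
    obtain e where e: "norm e = 1" "v = of_real (norm v) *s e"
      by (rule unit_direction)
    have "cinner (A *v v) v = of_real ((norm v)\<^sup>2) * cinner (A *v e) e"
      using form_scale[of A "norm v" e] e(2) by metis
    then have "Re (cinner (A *v v) v) = (norm v)\<^sup>2 * Re (cinner (A *v e) e)"
      by simp
    then show ?thesis
      using mult_left_mono[OF x(2)[OF e(1)], of "(norm v)\<^sup>2"] by (simp add: mult.commute)
  qed
  with x(1) show thesis by (rule that)
qed

theorem theorem3p1:
  fixes A :: "complex^'n^'n" and \<alpha> t :: real
  assumes "0 \<le> \<alpha>" and "\<alpha> < pi / 2"
    and "A \<in> sectorial \<alpha>" and "accretive A"
    and "0 < t" and "t < 1"
  shows "cos (t * \<alpha>) * cos \<alpha> powr t * numerical_radius A powr t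
           \<le> numerical_radius (principal_power A t)
       \<and> numerical_radius (principal_power A t)
           \<le> (1 / cos (t * \<alpha>)) * (1 / cos \<alpha>) powr (2 * t) * numerical_radius A powr t"
proof -
  note t = assms(5,6)
  let ?B = "\<lambda>x. cinner (principal_power A t *v x) x"
  let ?w = "numerical_radius A"
  have C: "0 < cos \<alpha>" using assms(1,2) by (intro cos_gt_zero_pi) auto
  have t\<alpha>: "0 \<le> t * \<alpha>" "t * \<alpha> < pi / 2"
    using assms(1,2) t mult_right_mono[of t 1 \<alpha>] by auto
  then have Ct: "0 < cos (t * \<alpha>)" by (intro cos_gt_zero_pi) auto
  obtain x where x: "norm x = 1" "\<And>v. Re (cinner (A *v v) v) \<le> Re (cinner (A *v x) x) * (norm v)\<^sup>2"
    using Re_form_attains_max[of A] by blast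
  define h where "h = Re (cinner (A *v x) x)"
  have "x \<noteq> 0" using x(1) by auto
  then have "0 < h"
    unfolding h_def by (rule accretive_form_pos[OF assms(4)])
  have h_le: "h \<le> ?w"
    using complex_Re_le_cmod[of "cinner (A *v x) x"] form_norm_le[of A x] x(1) by (simp add: h_def)
  then have "0 < ?w" using \<open>0 < h\<close> by simp
  \<comment> \<open>At a vector attaining \<open>?w\<close> the sector bounds the real form below by
    \<open>cos \<alpha> * ?w\<close>, and \<open>h\<close> is the maximum of that form.\<close>
  have w_le: "cos \<alpha> * ?w \<le> h"
  proof -
    obtain z where z: "norm z = 1" "cmod (cinner (A *v z) z) = ?w"
      using numerical_radius_attained[of A] by blast
    have "cos \<alpha> * cmod (cinner (A *v z) z) \<le> Re (cinner (A *v z) z)"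
      using sectorial_form[OF assms(3), of z] mult_right_mono[OF sectorial_form[OF assms(3), of
          z], of "cos \<alpha>"] assms(1,2) C
        accretive_form_nonneg[OF assms(4), of z]
      by (intro tan_bound_imp_cos_cmod_le) (auto simp: tan_def)
    also have "\<dots> \<le> h"
      using x(2)[of z] z(1) by (simp add: h_def)
    finally show ?thesis by (simp add: z(2))
  qed
  have lower: "cos (t * \<alpha>) * cos \<alpha> powr t * ?w powr t \<le> numerical_radius (principal_power A t)"
  proof -
    have "cos (t * \<alpha>) * (cos \<alpha> powr t * ?w powr t) \<le> 1 * (cos \<alpha> powr t * ?w powr t)"
      by (intro mult_right_mono) auto
    also have "\<dots> = (cos \<alpha> * ?w) powr t"
      using C \<open>0 < ?w\<close> by (simp add: powr_mult)
    also have "\<dots> \<le> h powr t"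
      using w_le C \<open>0 < ?w\<close> t by (intro powr_mono2) auto
    \<comment> \<open>The maximizer \<open>x\<close> is the test vector at which the scalar kernel
      with parameter \<open>h\<close> is a lower bound.\<close>
    also have "\<dots> \<le> Re (?B x)"
      using x h_def accretive_form_nonneg[OF assms(4)] \<open>0 < h\<close>
      by (intro Re_principal_power_bounds(3)[OF assms(4) t] resolvent_form_lower[of _ h x _ A]) auto
    also have "\<dots> \<le> numerical_radius (principal_power A t)"
      using complex_Re_le_cmod[of "?B x"] form_norm_le[of "principal_power A t" x] x(1) by simp
    finally show ?thesis by (simp add: mult.assoc)
  qed
  have upper: "numerical_radius (principal_power A t)
      \<le> (1 / cos (t * \<alpha>)) * (1 / cos \<alpha>) powr (2 * t) * ?w powr t"
  proof -
    obtain z where z: "norm z = 1" "cmod (?B z) = numerical_radius (principal_power A t)"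
      using numerical_radius_attained[of "principal_power A t"] by blast
    \<comment> \<open>\<open>resolvent_form_upper\<close> asks \<open>H\<close> to control both the
      real form and the image norm. Dividing the image estimate by
      \<open>(cos \<alpha>)\<^sup>2\<close> gives this value, which is at least
      \<open>?w\<close>.\<close>
    define H where "H = (1 / cos \<alpha>)\<^sup>2 * ?w"
    have "0 < H" using C \<open>0 < ?w\<close> by (simp add: H_def)
    have "?w \<le> H"
    proof -
      have "1 \<le> 1 / cos \<alpha>" using C by simp
      then have "1 \<le> (1 / cos \<alpha>)\<^sup>2" by (rule one_le_power)
      then show ?thesis
        unfolding H_def using mult_right_mono[of 1 "(1 / cos \<alpha>)\<^sup>2" ?w] \<open>0 < ?w\<close> by simp
    qed
    have form_le: "Re (cinner (A *v v) v) \<le> ?w * (norm v)\<^sup>2" for v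
      using complex_Re_le_cmod[of "cinner (A *v v) v"] form_norm_le[of A v] by linarith
    \<comment> \<open>The sector of half angle \<open>t * \<alpha>\<close> trades the modulus at the
      extremal vector \<open>z\<close> for the real part.\<close>
    have "cos (t * \<alpha>) * cmod (?B z) \<le> Re (?B z)"
      using principal_power_sectorial[OF assms(4,3,1,2) t] Re_principal_power_bounds(1)[OF
          assms(4) t] t\<alpha>
      by (intro tan_bound_imp_cos_cmod_le) auto
    also have "\<dots> \<le> H powr t"
    proof (rule Re_principal_power_bounds(2)[OF assms(4) t \<open>0 < H\<close>], rule resolvent_form_upper)
      fix l :: real and y assume y: "0 < l" "z = of_real l *s y + A *v y"
      show "Re (cinner (A *v y) y) \<le> H * (norm y)\<^sup>2"
        using form_le[of y] mult_right_mono[OF \<open>?w \<le> H\<close>, of "(norm y)\<^sup>2"] by simp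
      have "(cos \<alpha>)\<^sup>2 * (norm (A *v y))\<^sup>2 \<le> ?w * Re (cinner (A *v y) y)"
        by (rule sectorial_image_norm_le[OF assms(4,3,1,2) \<open>0 < ?w\<close> form_le])
      then show "(norm (A *v y))\<^sup>2 \<le> H * Re (cinner (A *v y) y)"
        using C by (simp add: H_def field_simps)
    qed (use \<open>0 < H\<close> z(1) in auto)
    also have "H powr t = (1 / cos \<alpha>) powr (2 * t) * ?w powr t"
    proof -
      have "(1 / cos \<alpha>)\<^sup>2 = (1 / cos \<alpha>) powr 2"
        using C by (simp add: powr_numeral)
      then have "((1 / cos \<alpha>)\<^sup>2) powr t = (1 / cos \<alpha>) powr (2 * t)"
        by (simp only: powr_powr)
      then show ?thesis
        using \<open>0 < ?w\<close> by (simp add: H_def powr_mult)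
    qed
    finally show ?thesis
      using Ct by (simp add: z(2) field_simps)
  qed
  from lower upper show ?thesis ..
qed

end
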